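(* Let $k$ be a field of characteristic $p>0$ and let $A:=k[[u,v]]$. Then there exists a $k$-algebra automorphism $\sigma:A\to A$ of order $p$ such that $\operatorname{Spec} A^{\langle\sigma\rangle}$ is a rational double point of type $A_{p-1}$, which has discriminant group $\Phi_{A_{p-1}}$ of order $p$. Any such automorphism induces a morphism $\operatorname{Spec} A\to\operatorname{Spec} A^{\langle\sigma\rangle}$ that must be ramified in codimension $1$.
   Context: A rational double point of type $A_{p-1}$ is a singularity whose complete local ring is isomorphic to $k[[x,y,z]]/(z^{p}-xy)$; its minimal resolution has exceptional divisor a chain of $p-1$ curves, each of self-intersection $-2$. The discriminant group of the intersection matrix $N\in \mathrm{Mat}_r(\mathbb{Z})$ of a resolution is $\Phi_N=\mathbb{Z}^r/N\mathbb{Z}^r$. For the group $G=\langle\sigma\rangle$, let $I=(\tau(a)-a\mid a\in A,\ \tau\in G)$. The action (or the morphism $\operatorname{Spec}A\to\operatorname{Spec}A^G$) is ramified precisely at the origin if the radical of $I$ is $(u,v)$; otherwise it is ramified in codimension $1$. *)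

theory Defs
  imports
    "HOL-Algebra.Algebraic_Closure_Type"
    "HOL-Algebra.Generated_Groups"
    "HOL-Algebra.Multiplicative_Group"
    "Jordan_Normal_Form.Matrix"
begin

text \<open>
  Power series in several variables are iterated: \<open>'k fps fps\<close> is \<open>k[[u]][[v]] = k[[u,v]]\<close> and
  \<open>'k fps fps fps\<close> is \<open>k[[x]][[y]][[z]] = k[[x,y,z]]\<close>.  The inner variables and the scalars are
  embedded with \<^const>\<open>fps_const\<close>.
\<close>

type_synonym 'k ps2 = "'k fps fps"
type_synonym 'k ps3 = "'k fps fps fps"

definition scalar2 :: "'k::field \<Rightarrow> 'k ps2"
  where "scalar2 c = fps_const (fps_const c)"

definition u2 :: "'k::field ps2" where "u2 = fps_const fps_X"
definition v2 :: "'k::field ps2" where "v2 = fps_X"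

definition scalar3 :: "'k::field \<Rightarrow> 'k ps3"
  where "scalar3 c = fps_const (fps_const (fps_const c))"

definition x3 :: "'k::field ps3" where "x3 = fps_const (fps_const fps_X)"
definition y3 :: "'k::field ps3" where "y3 = fps_const fps_X"
definition z3 :: "'k::field ps3" where "z3 = fps_X"

abbreviation PS2 :: "'k::field ps2 ring" where "PS2 \<equiv> ring_of_type_algebra"
abbreviation PS3 :: "'k::field ps3 ring" where "PS3 \<equiv> ring_of_type_algebra"


subsection \<open>Automorphisms of \<open>k[[u,v]]\<close> and rings of invariants\<close>

definition kalg_aut :: "('k::field ps2 \<Rightarrow> 'k ps2) monoid"
  where "kalg_aut =
    \<lparr>carrier = {\<sigma> \<in> ring_iso PS2 PS2. \<forall>c. \<sigma> (scalar2 c) = scalar2 c},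
     monoid.mult = (\<circ>), one = id\<rparr>"

text \<open>\<^const>\<open>group.ord\<close> and \<^const>\<open>generate\<close> have their usual meaning only in a group.\<close>

lemma group_kalg_aut: "group (kalg_aut :: ('k::field ps2 \<Rightarrow> 'k ps2) monoid)"
proof (rule groupI)
  fix \<sigma> :: "'k ps2 \<Rightarrow> 'k ps2"
  assume s: "\<sigma> \<in> carrier kalg_aut"
  then have b: "bij \<sigma>"
    by (auto simp: kalg_aut_def ring_iso_def ring_of_type_algebra_def)
  have "inv_into UNIV \<sigma> \<in> carrier kalg_aut"
  proof -
    have "inv_into UNIV \<sigma> \<in> ring_iso PS2 PS2"
      using ring_iso_set_sym[of PS2 \<sigma> PS2] s
      by (simp add: kalg_aut_def ring_of_type_algebra_def
          ring_from_type_algebra[unfolded ring_of_type_algebra_def])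
    moreover have "inv_into UNIV \<sigma> (scalar2 c) = scalar2 c" for c
      using s b by (metis (mono_tags, lifting) bij_inv_eq_iff kalg_aut_def mem_Collect_eq
          partial_object.select_convs(1))
    ultimately show ?thesis by (simp add: kalg_aut_def)
  qed
  then show "\<exists>\<tau>\<in>carrier kalg_aut. \<tau> \<otimes>\<^bsub>kalg_aut\<^esub> \<sigma> = \<one>\<^bsub>kalg_aut\<^esub>"
    using b by (intro bexI[of _ "inv_into UNIV \<sigma>"]) (auto simp: kalg_aut_def bij_is_inj)
qed (auto simp: kalg_aut_def ring_iso_def Ring.ring_hom_def ring_of_type_algebra_def
      intro: bij_comp bij_id)

definition invariant_ring :: "('k::field ps2 \<Rightarrow> 'k ps2) \<Rightarrow> 'k ps2 ring"
  where "invariant_ring \<sigma> =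
    PS2\<lparr>carrier := {a. \<forall>\<tau> \<in> generate kalg_aut {\<sigma>}. \<tau> a = a}\<rparr>"


subsection \<open>Rational double points of type \<open>A\<^sub>r\<close>\<close>

definition rdp_A_ideal :: "nat \<Rightarrow> 'k::field ps3 set"
  where "rdp_A_ideal r = PIdl\<^bsub>PS3\<^esub> (z3 ^ (r + 1) - x3 * y3)"

text \<open>
  The argument \<open>R\<close> is a complete local ring, with \<open>k\<close>-algebra structure given by \<open>\<iota>\<close>.
  The isomorphism is one of \<open>k\<close>-algebras.
\<close>

definition is_rdp_A :: "nat \<Rightarrow> ('k::field \<Rightarrow> 'a) \<Rightarrow> 'a ring \<Rightarrow> bool"
  where "is_rdp_A r \<iota> R \<longleftrightarrow>
    (\<exists>\<phi> \<in> ring_iso R (PS3 Quot (rdp_A_ideal r :: 'k ps3 set)).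
       \<forall>c. \<phi> (\<iota> c) = rdp_A_ideal r +>\<^bsub>PS3\<^esub> scalar3 c)"


subsection \<open>Discriminant groups\<close>

definition discriminant_group :: "int mat \<Rightarrow> int vec set monoid"
  where "discriminant_group N =
    monoid_vec TYPE(int) (dim_row N) Mod {N *\<^sub>v w | w. w \<in> carrier_vec (dim_col N)}"

text \<open>
  The intersection matrix of the exceptional divisor of the minimal resolution of a rational
  double point of type \<open>A\<^sub>r\<close>: a chain of \<open>r\<close> curves, each of self-intersection \<open>-2\<close>,
  consecutive ones meeting transversally in one point.
\<close>

definition A_intersection_matrix :: "nat \<Rightarrow> int mat"
  where "A_intersection_matrix r =
    mat r r (\<lambda>(i, j). if i = j then -2 else if i = j + 1 \<or> j = i + 1 then 1 else 0)"


subsection \<open>Ramification\<close>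

definition ramification_ideal :: "('k::field ps2 \<Rightarrow> 'k ps2) \<Rightarrow> 'k ps2 set"
  where "ramification_ideal \<sigma> =
    Idl\<^bsub>PS2\<^esub> {\<tau> a - a | \<tau> a. \<tau> \<in> generate kalg_aut {\<sigma>}}"

definition ideal_radical :: "'a::comm_ring_1 set \<Rightarrow> 'a set"
  where "ideal_radical J = {a. \<exists>n::nat. a ^ n \<in> J}"

definition ramified_precisely_at_origin :: "('k::field ps2 \<Rightarrow> 'k ps2) \<Rightarrow> bool"
  where "ramified_precisely_at_origin \<sigma> \<longleftrightarrow>
    ideal_radical (ramification_ideal \<sigma>) = Idl\<^bsub>PS2\<^esub> {u2, v2}"

text \<open>
  For a nontrivial automorphism of finite \<open>p\<close>-power order, the ramification ideal is nonzero and
  contained in \<open>(u, v)\<close>, so this is the only alternative.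
\<close>

definition ramified_in_codim_1 :: "('k::field ps2 \<Rightarrow> 'k ps2) \<Rightarrow> bool"
  where "ramified_in_codim_1 \<sigma> \<longleftrightarrow> \<not> ramified_precisely_at_origin \<sigma>"

end

theory Submission
  imports Defs "HOL-Number_Theory.Cong"
begin

text \<open>
  The automorphism \<open>u \<mapsto> u / (1 + u)\<close>, \<open>v \<mapsto> v (1 + u)\<close> has order \<open>p\<close> and fixes \<open>z = u v\<close>,
  \<open>x = u\<^sup>p / (1 - u\<^sup>p\<^sup>-\<^sup>1)\<close> and \<open>y = v\<^sup>p (1 - u\<^sup>p\<^sup>-\<^sup>1)\<close>, the norms of \<open>u\<close> and \<open>v\<close>, so that \<open>x y = z\<^sup>p\<close>.
  It preserves the grading by powers of \<open>v\<close>, which reduces the computation of its invariants to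
  \<open>k[[u]]\<close>: a series fixed by \<open>u \<mapsto> u / (1 + u)\<close> has order divisible by \<open>p\<close>, hence lies in \<open>k[[x]]\<close>.

  Conversely suppose that an action with such invariants \<open>B\<close> is ramified precisely at the origin.
  Powers of \<open>x\<close> and \<open>y\<close> are then traces, which gives \<open>a\<close> and \<open>b\<close> with \<open>\<sigma> a = a + x\<^sup>n\<close>, \<open>\<sigma> b = b + y\<^sup>n\<close>.
  The class of \<open>c = y\<^sup>n a - x\<^sup>n b \<in> B\<close> over \<open>x\<^sup>n y\<^sup>n\<close> in the second local cohomology group of \<open>B\<close> is fixed by
  Frobenius. That group is negatively graded and Frobenius multiplies degrees by \<open>p\<close>, so the class is
  zero: \<open>c \<in> (x\<^sup>n, y\<^sup>n) B\<close>. As \<open>x\<^sup>n, y\<^sup>n\<close> is a regular sequence in \<open>k[[u,v]]\<close>, some \<open>h\<close> satisfies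
  \<open>\<sigma> h = h + 1\<close>, which is impossible since \<open>\<sigma>\<close> acts trivially on the residue field.
\<close>

no_notation vec_index (infixl "$" 100)

lemma prime_CHAR_field:
  assumes "CHAR('k::field) = p" and "p > 0"
  shows "prime p"
  using prime_CHAR_semidom[where 'a='k] assms by simp

section \<open>Monomial models of \<open>k[[x,y,z]]/(z\<^sup>p - x y)\<close> in \<open>k[[u,v]]\<close>\<close>

text \<open>This specialises the two variables to a single one.\<close>

definition diag :: "'r::comm_ring_1 fps fps \<Rightarrow> 'r fps"
  where "diag G = Abs_fps (\<lambda>N. \<Sum>i\<le>N. G $ i $ (N - i))"

lemma diag_nth: "diag G $ N = (\<Sum>i\<le>N. G $ i $ (N - i))"
  by (simp add: diag_def)

lemma diag_mult: "diag (F * G) = diag F * diag (G :: 'r::comm_ring_1 fps fps)"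
proof (rule fps_ext)
  fix N
  have "diag (F * G) $ N =
      (\<Sum>i\<le>N. \<Sum>a\<le>i. \<Sum>b\<le>N - i. F $ a $ b * G $ (i - a) $ (N - i - b))"
    by (simp add: diag_nth fps_mult_nth fps_sum_nth atMost_atLeast0)
  also have "\<dots> = (\<Sum>(i, a, b) \<in> (SIGMA i:{..N}. {..i} \<times> {..N - i}).
      F $ a $ b * G $ (i - a) $ (N - i - b))"
    by (simp add: sum.Sigma sum.cartesian_product)
  \<comment> \<open>Here \<open>m\<close> is the total degree taken from \<open>F\<close> and
    \<open>c\<close> the first exponent taken from \<open>G\<close>, in place of the sum
    \<open>i\<close> of the first exponents.\<close>
  also have "\<dots> = (\<Sum>(m, a, c) \<in> (SIGMA m:{..N}. {..m} \<times> {..N - m}).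
      F $ a $ (m - a) * G $ c $ (N - m - c))"
    by (rule sum.reindex_bij_witness[where
          i = "\<lambda>(m, a, c). (a + c, a, m - a)" and j = "\<lambda>(i, a, b). (a + b, a, i - a)"])
       (auto simp: diff_add_eq algebra_simps)
  also have "\<dots> = (\<Sum>m\<le>N. \<Sum>a\<le>m. \<Sum>c\<le>N - m. F $ a $ (m - a) * G $ c $ (N - m - c))"
    by (simp add: sum.Sigma sum.cartesian_product)
  also have "\<dots> = (diag F * diag G) $ N"
    by (simp add: diag_nth fps_mult_nth atMost_atLeast0 sum_product)
  finally show "diag (F * G) $ N = (diag F * diag G) $ N" .
qed

text \<open>The unit \<open>w\<close> is left open since two models occur:
  \<open>w = 1 - fps_X ^ (p - 1)\<close> describes the invariants of the shear, and
  \<open>w = 1\<close> is a monomial model for degree arguments.\<close>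

locale monomial_model =
  fixes p :: nat and w :: "'k::field fps"
  assumes p_pos: "p > 0" and w_unit: "w $ 0 \<noteq> 0"
begin

definition \<xi> :: "'k fps" where "\<xi> = fps_X ^ p * inverse w"

lemma xi_0: "\<xi> $ 0 = 0" using p_pos by (simp add: \<xi>_def)

lemma w_nz: "w \<noteq> 0" using w_unit by auto

lemma xi_w: "\<xi> * w = fps_X ^ p"
  by (simp add: \<xi>_def mult.assoc inverse_mult_eq_1 w_unit)

lemma xi_nz: "\<xi> \<noteq> 0"
  using xi_w by auto

text \<open>The \<open>u\<close>-part of the substitution, with \<open>F $ i $ j\<close> the
  coefficient of \<open>z^i y^j\<close>; the matching powers of \<open>v\<close> are supplied by the
  diagonal in \<open>\<Psi>\<close>.\<close>

definition weighted :: "'k ps3 \<Rightarrow> 'k fps fps fps"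
  where "weighted F = Abs_fps (\<lambda>i. Abs_fps (\<lambda>j. fps_X ^ i * w ^ j * (F $ i $ j oo \<xi>)))"

text \<open>The substitution \<open>x = u\<^sup>p / w\<close>, \<open>y = v\<^sup>p w\<close>, \<open>z = u v\<close>.\<close>
definition \<Psi> :: "'k ps3 \<Rightarrow> 'k ps2"
  where "\<Psi> F = diag (Abs_fps (\<lambda>i. weighted F $ i oo fps_X ^ p))"

lemma weighted_nth: "weighted F $ i $ j = fps_X ^ i * w ^ j * (F $ i $ j oo \<xi>)"
  by (simp add: weighted_def)

lemma weighted_mult: "weighted (F * G) = weighted F * weighted G"
proof (intro fps_ext[where ?'a = "'k fps"] fps_ext[where ?'a = "'k fps fps"])
  fix i j
  have "weighted (F * G) $ i $ j =
     (\<Sum>a=0..i. \<Sum>b=0..j. fps_X ^ i * w ^ j * ((F $ a $ b oo \<xi>) * (G $ (i - a) $ (j - b) oo \<xi>)))"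
    by (simp add: weighted_nth fps_mult_nth fps_sum_nth fps_compose_sum_distrib
        fps_compose_mult_distrib[OF xi_0] sum_distrib_left)
  also have "\<dots> = (\<Sum>a=0..i. \<Sum>b=0..j. weighted F $ a $ b * weighted G $ (i - a) $ (j - b))"
  proof (intro sum.cong refl)
    fix a b assume ab: "a \<in> {0..i}" "b \<in> {0..j}"
    have "fps_X ^ i = fps_X ^ a * (fps_X ^ (i - a) :: 'k fps)" "w ^ j = w ^ b * w ^ (j - b)"
      using ab by (simp_all flip: power_add)
    then show "fps_X ^ i * w ^ j * ((F $ a $ b oo \<xi>) * (G $ (i - a) $ (j - b) oo \<xi>)) =
        weighted F $ a $ b * weighted G $ (i - a) $ (j - b)"
      by (simp only: weighted_nth mult_ac)
  qed
  also have "\<dots> = (weighted F * weighted G) $ i $ j"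
    by (simp add: fps_mult_nth fps_sum_nth)
  finally show "weighted (F * G) $ i $ j = (weighted F * weighted G) $ i $ j" .
qed

lemma Psi_nth:
  "\<Psi> F $ N = (\<Sum>i\<le>N. if p dvd N - i
     then fps_X ^ i * w ^ ((N - i) div p) * (F $ i $ ((N - i) div p) oo \<xi>) else 0)"
  by (simp add: \<Psi>_def diag_nth fps_nth_compose_X_power weighted_nth cong: if_cong)

lemma Psi_add: "\<Psi> (F + G) = \<Psi> F + \<Psi> G"
  by (rule fps_ext) (auto simp: Psi_nth fps_compose_add_distrib algebra_simps sum.distrib[symmetric] intro!: sum.cong)

lemma Psi_mult: "\<Psi> (F * G) = \<Psi> F * \<Psi> G"
proof -
  have "(Abs_fps (\<lambda>i. weighted (F * G) $ i oo fps_X ^ p)) =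
     Abs_fps (\<lambda>i. weighted F $ i oo fps_X ^ p) * Abs_fps (\<lambda>i. weighted G $ i oo fps_X ^ p)"
    using p_pos
    by (intro fps_ext[where ?'a = "'k fps fps"])
       (simp add: weighted_mult fps_mult_nth[where 'a = "'k fps fps"] fps_compose_sum_distrib fps_compose_mult_distrib)
  then show ?thesis by (simp add: \<Psi>_def diag_mult)
qed

lemma Psi_const: "\<Psi> (fps_const (fps_const f)) = fps_const (f oo \<xi>)"
proof (rule fps_ext)
  fix N
  have "\<Psi> (fps_const (fps_const f)) $ N = (\<Sum>i\<le>N. if i = 0 then (if N = 0 then f oo \<xi> else 0) else 0)"
    unfolding Psi_nth using p_pos by (intro sum.cong refl) (auto simp: dvd_div_eq_0_iff)
  then show "\<Psi> (fps_const (fps_const f)) $ N = fps_const (f oo \<xi>) $ N"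
    by simp
qed

lemma Psi_x: "\<Psi> x3 = fps_const \<xi>"
  by (simp add: x3_def Psi_const xi_0 fps_X_fps_compose_startby0)

lemma Psi_1: "\<Psi> 1 = 1"
  using Psi_const[of 1] by simp

lemma Psi_scalar: "\<Psi> (scalar3 c) = scalar2 c"
  by (simp add: scalar3_def scalar2_def Psi_const)

lemma Psi_y: "\<Psi> y3 = fps_const w * fps_X ^ p"
proof (rule fps_ext)
  fix N
  have "\<Psi> y3 $ N = (\<Sum>i\<le>N. if i = 0 then (if N = p then w else 0) else 0)"
    unfolding Psi_nth y3_def using p_pos by (intro sum.cong refl) (auto simp: div_eq_dividend_iff)
  then show "\<Psi> y3 $ N = (fps_const w * fps_X ^ p) $ N"
    by (simp add: fps_X_power_nth)
qed

lemma Psi_z: "\<Psi> z3 = fps_const fps_X * fps_X"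
proof (rule fps_ext)
  fix N
  have "\<Psi> z3 $ N = (\<Sum>i\<le>N. if i = 1 then (if N = 1 then fps_X else 0) else 0)"
    unfolding Psi_nth z3_def using p_pos by (intro sum.cong refl) (auto simp: dvd_div_eq_0_iff)
  then show "\<Psi> z3 $ N = (fps_const fps_X * fps_X) $ N"
    by simp
qed

lemma Psi_minus: "\<Psi> (F - G) = \<Psi> F - \<Psi> G"
  using Psi_add[of "F - G" G] by (simp add: algebra_simps)

lemma Psi_power: "\<Psi> (F ^ n) = \<Psi> F ^ n"
  by (induction n) (simp_all add: Psi_1 Psi_mult)

lemma Psi_relation: "\<Psi> (z3 ^ p - x3 * y3) = 0"
proof -
  have "\<Psi> (z3 ^ p - x3 * y3) = fps_const (fps_X ^ p) * fps_X ^ p - fps_const (\<xi> * w) * fps_X ^ p"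
    by (simp add: Psi_minus Psi_power Psi_mult Psi_x Psi_y Psi_z power_mult_distrib
        fps_const_power mult.assoc flip: fps_const_mult)
  then show ?thesis by (simp add: xi_w)
qed

text \<open>When the exponent of \<open>z\<close> stays below \<open>p\<close>, the exponent
  \<open>N\<close> of \<open>v\<close> determines those of \<open>z\<close> and \<open>y\<close> as
  its remainder and quotient by \<open>p\<close>, so a single term of the sum survives.\<close>

lemma Psi_remainder_nth:
  assumes "\<And>i. i \<ge> p \<Longrightarrow> R $ i = 0"
  shows "\<Psi> R $ N = fps_X ^ (N mod p) * w ^ (N div p) * (R $ (N mod p) $ (N div p) oo \<xi>)"
proof -
  have "\<Psi> R $ N = (\<Sum>i\<le>N. if i = N mod p
      then fps_X ^ (N mod p) * w ^ (N div p) * (R $ (N mod p) $ (N div p) oo \<xi>) else 0)"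
    unfolding Psi_nth
  proof (intro sum.cong refl)
    fix i assume i: "i \<in> {..N}"
    show "(if p dvd N - i then fps_X ^ i * w ^ ((N - i) div p) * (R $ i $ ((N - i) div p) oo \<xi>) else 0) =
      (if i = N mod p then fps_X ^ (N mod p) * w ^ (N div p) * (R $ (N mod p) $ (N div p) oo \<xi>) else 0)"
    proof (cases "i < p")
      case True
      then have "p dvd N - i \<longleftrightarrow> i = N mod p"
        using i by (metis atMost_iff dvd_minus_mod mod_eq_dvd_iff_nat mod_less)
      moreover have "(N - N mod p) div p = N div p"
        by (simp add: minus_mod_eq_mult_div p_pos)
      ultimately show ?thesis by auto
    next
      case False
      then have "i \<noteq> N mod p" using p_pos by (metis mod_less_divisor)
      with False show ?thesis using assms[of i] by simp
    qed
  qed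
  also have "\<dots> = fps_X ^ (N mod p) * w ^ (N div p) * (R $ (N mod p) $ (N div p) oo \<xi>)"
    by simp
  finally show ?thesis .
qed

text \<open>Each coefficient of \<open>R\<close> is isolated in one coefficient of
  \<open>\<Psi> R\<close>, and composition with the nonzero \<open>\<xi>\<close> is
  injective.\<close>

lemma remainder_zero:
  assumes R: "\<And>i. i \<ge> p \<Longrightarrow> R $ i = 0" and "\<Psi> R = 0"
  shows "R = 0"
proof (intro fps_ext)
  fix i j n
  show "R $ i $ j $ n = 0 $ i $ j $ n"
  proof (cases "i < p")
    case True
    have "\<Psi> R $ (i + p * j) = 0" using assms by simp
    then have "(R $ i $ j) oo \<xi> = 0"
      using True by (simp add: Psi_remainder_nth[OF R] w_nz)
    then have "R $ i $ j = 0"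
      by (simp add: fps_compose_eq_0_iff[OF xi_0] xi_nz)
    then show ?thesis by simp
  qed (simp add: R)
qed

end

section \<open>Division by the relation; kernel and range of the substitution\<close>

lemma mult_x3_nth: "(x3 * F) $ i $ j = fps_X * F $ i $ j"
  by (simp add: x3_def)

lemma mult_y3_nth: "(y3 * F) $ i $ j = (if j = 0 then 0 else F $ i $ (j - 1))"
  by (simp add: y3_def)

lemma mult_z3_power_nth: "(z3 ^ n * F) $ i = (if i < n then 0 else F $ (i - n))"
  by (simp add: z3_def fps_X_power_mult_nth)

text \<open>Weierstrass division, with the quotient given by the geometric series of \<open>x y / z\<^sup>p\<close>.\<close>
lemma weierstrass_division:
  fixes F :: "'k::field ps3"
  assumes "p > 0"
  shows "\<exists>Q R. F = Q * (z3 ^ p - x3 * y3) + R \<and> (\<forall>i\<ge>p. R $ i = 0)"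
proof -
  define Q :: "'k ps3" where
    "Q = Abs_fps (\<lambda>m. Abs_fps (\<lambda>j. \<Sum>l\<le>j. fps_X ^ l * F $ (m + p + p * l) $ (j - l)))"
  \<comment> \<open>Separating the term \<open>l = 0\<close> gives the recursion that equates the
    \<open>z\<close>-coefficients of \<open>Q * (z3 ^ p - x3 * y3)\<close> and \<open>F\<close> from
    degree \<open>p\<close> on.\<close>
  have rec: "Q $ m $ j - (if j = 0 then 0 else fps_X * Q $ (m + p) $ (j - 1)) = F $ (m + p) $ j" for m j
  proof (cases j)
    case (Suc j')
    have "Q $ m $ j = F $ (m + p) $ j + (\<Sum>l\<le>j'. fps_X ^ Suc l * F $ (m + p + p * Suc l) $ (j' - l))"
      by (simp add: Q_def Suc sum.atMost_Suc_shift del: sum.atMost_Suc)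
    also have "(\<Sum>l\<le>j'. fps_X ^ Suc l * F $ (m + p + p * Suc l) $ (j' - l)) = fps_X * Q $ (m + p) $ j'"
      by (simp add: Q_def sum_distrib_left mult.assoc algebra_simps)
    finally show ?thesis by (simp add: Suc)
  qed (simp add: Q_def)
  define R where "R = F - Q * (z3 ^ p - x3 * y3)"
  have "R $ i = 0" if "i \<ge> p" for i
  proof (rule fps_ext)
    fix j
    have "Q * (z3 ^ p - x3 * y3) = z3 ^ p * Q - x3 * (y3 * Q)" by (simp add: algebra_simps)
    then have "(Q * (z3 ^ p - x3 * y3)) $ i $ j =
        Q $ (i - p) $ j - (if j = 0 then 0 else fps_X * Q $ i $ (j - 1))"
      using that by (simp add: mult_z3_power_nth mult_x3_nth mult_y3_nth)
    also have "\<dots> = F $ i $ j" using rec[of "i - p" j, unfolded le_add_diff_inverse2[OF that]] by simp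
    finally show "R $ i $ j = 0 $ j" by (simp add: R_def)
  qed
  then show ?thesis by (intro exI[of _ Q] exI[of _ R]) (simp add: R_def)
qed

context monomial_model
begin

text \<open>Division reduces \<open>F\<close> to a remainder with the same image, and remainders
  embed.\<close>

theorem Psi_eq_0_iff: "\<Psi> F = 0 \<longleftrightarrow> (\<exists>Q. F = Q * (z3 ^ p - x3 * y3))"
proof
  assume F: "\<Psi> F = 0"
  obtain Q R where QR: "F = Q * (z3 ^ p - x3 * y3) + R" "\<forall>i\<ge>p. R $ i = 0"
    using weierstrass_division[OF p_pos] by blast
  then have "\<Psi> R = 0"
    using F by (simp add: Psi_add Psi_mult Psi_relation)
  then have "R = 0" using QR(2) remainder_zero by blast
  then show "\<exists>Q. F = Q * (z3 ^ p - x3 * y3)" using QR by auto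
qed (auto simp: Psi_mult Psi_relation)

text \<open>The hypothesis is the shape of the coefficients of images of remainders, so a preimage
  can be assembled as a remainder.\<close>

lemma range_Psi:
  assumes "\<And>N. \<exists>h. a $ N = fps_X ^ (N mod p) * w ^ (N div p) * (h oo \<xi>)"
  shows "a \<in> range \<Psi>"
proof -
  obtain h where h: "\<And>N. a $ N = fps_X ^ (N mod p) * w ^ (N div p) * (h N oo \<xi>)"
    using assms by metis
  define F where "F = Abs_fps (\<lambda>i. Abs_fps (\<lambda>j. if i < p then h (i + p * j) else 0))"
  have F0: "F $ i = 0" if "i \<ge> p" for i
    using that by (simp add: F_def fps_zero_def)
  have "F $ (N mod p) $ (N div p) = h N" for N
    using p_pos by (simp add: F_def)
  then have "\<Psi> F = a"
    by (intro fps_ext) (simp add: Psi_remainder_nth[OF F0] h)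
  then show ?thesis by blast
qed

end

section \<open>An automorphism of order \<open>p\<close> and its invariants\<close>

text \<open>Allowing a parameter \<open>c\<close> gives a one-parameter group, so that iterates and
  inverses of the shear are shears.\<close>

definition \<theta> :: "'k::field \<Rightarrow> 'k fps"
  where "\<theta> c = fps_X * inverse (1 + fps_const c * fps_X)"

definition shear :: "'k::field \<Rightarrow> 'k ps2 \<Rightarrow> 'k ps2"
  where "shear c a = Abs_fps (\<lambda>n. (a $ n oo \<theta> c) * (1 + fps_const c * fps_X) ^ n)"

lemma theta_0: "\<theta> c $ 0 = 0" by (simp add: \<theta>_def)

lemma theta_mult: "\<theta> c * (1 + fps_const c * fps_X) = fps_X"
  by (simp add: \<theta>_def mult.assoc inverse_mult_eq_1)

lemma one_plus_nz: "1 + fps_const c * fps_X \<noteq> (0 :: 'k::field fps)"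
proof
  assume "1 + fps_const c * fps_X = (0 :: 'k fps)"
  then have "(1 + fps_const c * fps_X) $ 0 = (0 :: 'k fps) $ 0" by simp
  then show False by simp
qed

lemma theta_zero: "\<theta> 0 = fps_X" by (simp add: \<theta>_def)

text \<open>This cocycle identity for the factor by which \<open>v\<close> is multiplied makes the
  parameters add under composition.\<close>

lemma one_plus_compose:
  "((1 + fps_const c * fps_X) oo \<theta> d) * (1 + fps_const d * fps_X) = 1 + fps_const (c + d) * fps_X"
proof -
  have "((1 + fps_const c * fps_X) oo \<theta> d) = 1 + fps_const c * \<theta> d"
    by (simp add: fps_compose_add_distrib fps_compose_mult_distrib theta_0 fps_X_fps_compose_startby0)
  then have "((1 + fps_const c * fps_X) oo \<theta> d) * (1 + fps_const d * fps_X) =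
     1 + fps_const d * fps_X + fps_const c * (\<theta> d * (1 + fps_const d * fps_X))"
    by (simp only: distrib_right mult_1_left mult.assoc)
  then show ?thesis by (simp only: theta_mult) (simp add: algebra_simps flip: fps_const_add)
qed

lemma theta_compose: "\<theta> c oo \<theta> d = \<theta> (c + d)"
proof -
  have "(\<theta> c oo \<theta> d) * (1 + fps_const (c + d) * fps_X) =
    ((\<theta> c * (1 + fps_const c * fps_X)) oo \<theta> d) * (1 + fps_const d * fps_X)"
    by (simp add: one_plus_compose fps_compose_mult_distrib theta_0 mult.assoc del: fps_const_add)
  also have "\<dots> = \<theta> (c + d) * (1 + fps_const (c + d) * fps_X)"
    by (simp add: theta_mult fps_X_fps_compose_startby0 theta_0 del: fps_const_add)
  finally show ?thesis
    using one_plus_nz[of "c + d"] by (simp del: fps_const_add)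
qed

lemma shear_nth: "shear c a $ n = (a $ n oo \<theta> c) * (1 + fps_const c * fps_X) ^ n"
  by (simp add: shear_def)

lemma shear_add: "shear c (a + b) = shear c a + shear c b"
  by (rule fps_ext) (simp add: shear_nth fps_compose_add_distrib algebra_simps)

lemma shear_mult: "shear c (a * b) = shear c a * shear c b"
proof (rule fps_ext)
  fix n
  let ?t = "1 + fps_const c * fps_X"
  have "shear c (a * b) $ n = (\<Sum>i=0..n. (a $ i oo \<theta> c) * (b $ (n - i) oo \<theta> c) * ?t ^ n)"
    by (simp add: shear_nth fps_mult_nth fps_compose_sum_distrib fps_compose_mult_distrib theta_0
        sum_distrib_right)
  also have "\<dots> = (\<Sum>i=0..n. shear c a $ i * shear c b $ (n - i))"
  proof (intro sum.cong refl)
    fix i assume "i \<in> {0..n}"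
    then have "?t ^ n = ?t ^ i * ?t ^ (n - i)" by (simp flip: power_add)
    then show "(a $ i oo \<theta> c) * (b $ (n - i) oo \<theta> c) * ?t ^ n = shear c a $ i * shear c b $ (n - i)"
      by (simp only: shear_nth mult_ac)
  qed
  finally show "shear c (a * b) $ n = (shear c a * shear c b) $ n"
    by (simp add: fps_mult_nth)
qed

lemma shear_scalar: "shear c (scalar2 d) = scalar2 d"
proof (rule fps_ext)
  show "shear c (scalar2 d) $ n = scalar2 d $ n" for n
    by (cases n) (simp_all add: shear_nth scalar2_def)
qed

lemma shear_shear: "shear c (shear d a) = shear (c + d) a"
  by (rule fps_ext)
     (simp add: shear_nth fps_compose_mult_distrib theta_0 fps_compose_power[symmetric]
        fps_compose_assoc[symmetric] theta_compose mult.assoc add.commute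
        power_mult_distrib[symmetric] one_plus_compose del: fps_const_add)

lemma shear_0: "shear 0 a = a"
  by (rule fps_ext) (simp add: shear_nth theta_zero)

lemma shear_v: "shear c v2 = fps_const (1 + fps_const c * fps_X) * v2"
proof (rule fps_ext)
  show "shear c v2 $ n = (fps_const (1 + fps_const c * fps_X) * v2) $ n" for n
    by (cases "n = 1") (simp_all add: shear_nth v2_def)
qed

lemma shear_eq_id_iff: "shear c = id \<longleftrightarrow> c = 0"
proof
  assume "shear c = id"
  then have "shear c v2 $ 1 $ 1 = v2 $ 1 $ 1" by simp
  then show "c = 0" unfolding shear_v by (simp add: v2_def)
qed (auto simp: shear_0 fun_eq_iff)

text \<open>Write \<open>f = u^s g\<close> with nonzero \<open>g $ 0\<close>. The powers of
  \<open>u\<close> cancel and leave \<open>g (1 + u)^s\<close> equal to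
  \<open>(g oo \<theta> 1) (1 + u)^i\<close>. As \<open>\<theta> 1\<close> is \<open>u\<close> to
  first order, the linear coefficients force \<open>s = i\<close> in \<open>k\<close>.\<close>

lemma semi_invariant_subdegree:
  fixes f :: "'k::field fps"
  assumes "f \<noteq> 0" and "(f oo \<theta> 1) * (1 + fps_X) ^ i = f"
  shows "subdegree f mod CHAR('k) = i mod CHAR('k)"
proof -
  define s :: nat where "s = subdegree f"
  define g where "g = fps_shift s f"
  have f: "f = fps_X ^ s * g" and g0: "g $ 0 \<noteq> 0"
    using assms(1) subdegree_decompose[of f] unfolding s_def g_def by (auto simp: mult.commute)
  let ?t = "1 + fps_X :: 'k fps"
  have th: "\<theta> 1 * ?t = fps_X" using theta_mult[of "1::'k"] by simp
  have "fps_X ^ s * (g * ?t ^ s) = f * ?t ^ s" by (simp add: f)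
  also have "\<dots> = (\<theta> 1 ^ s * (g oo \<theta> 1)) * ?t ^ i * ?t ^ s"
    using assms(2) by (simp add: f fps_compose_mult_distrib theta_0 fps_compose_power[symmetric]
        fps_X_fps_compose_startby0)
  also have "\<dots> = (\<theta> 1 * ?t) ^ s * ((g oo \<theta> 1) * ?t ^ i)"
    by (simp add: power_mult_distrib mult_ac)
  finally have "g * ?t ^ s = (g oo \<theta> 1) * ?t ^ i" by (simp add: th)
  then have eq: "(g * ?t ^ s) $ 1 = ((g oo \<theta> 1) * ?t ^ i) $ 1" by simp
  have t0: "(?t ^ n) $ 0 = 1" for n
    by (induction n) simp_all
  have t1: "(?t ^ n) $ Suc 0 = of_nat n" for n
    by (induction n) (simp_all add: fps_mult_nth_1 t0)
  have "\<theta> 1 $ 1 = (1::'k)" by (simp add: \<theta>_def)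
  then have "(g oo \<theta> 1) $ Suc 0 = g $ 1" by (simp add: fps_compose_nth theta_0)
  with eq have "g $ 0 * of_nat s = g $ 0 * of_nat i"
    by (simp add: fps_mult_nth_1 t1 t0)
  then have "(of_nat s :: 'k) = of_nat i" using g0 by simp
  then show ?thesis by (simp add: s_def of_nat_eq_iff_cong_CHAR cong_def)
qed

section \<open>Invariants of the shear in characteristic \<open>p\<close>\<close>

locale char_p_field =
  fixes p :: nat and ty :: "'k::field itself"
  assumes char: "CHAR('k) = p" and pos: "p > 0"
begin

lemma prime_p: "prime p" using prime_CHAR_field char pos by blast

lemma p_gt_1: "p > 1" using prime_p prime_gt_1_nat by blast

definition w :: "'k fps" where "w = 1 - fps_X ^ (p - 1)"

sublocale monomial_model p w
  using p_gt_1 by unfold_locales (auto simp: w_def)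

lemma fps_freshman: "((x::'k fps) + y) ^ p = x ^ p + y ^ p"
  by (rule freshmans_dream) (simp_all add: char prime_p)

text \<open>Since \<open>(1 + u)^p = 1 + u^p\<close>, the two terms \<open>u^p\<close> cancel. This
  is the invariance of \<open>y = v^p w\<close>.\<close>

lemma w_theta: "(w oo \<theta> 1) * (1 + fps_X) ^ p = w"
proof -
  let ?t = "1 + fps_X :: 'k fps"
  have th: "\<theta> 1 * ?t = fps_X" using theta_mult[of "1::'k"] by simp
  have "w oo \<theta> 1 = 1 - \<theta> 1 ^ (p - 1)"
    by (simp add: w_def fps_compose_sub_distrib fps_compose_power[symmetric] theta_0 fps_X_fps_compose_startby0)
  then have "(w oo \<theta> 1) * ?t ^ p = ?t ^ p - \<theta> 1 ^ (p - 1) * ?t ^ p"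
    by (simp add: left_diff_distrib)
  also have "\<theta> 1 ^ (p - 1) * ?t ^ p = (\<theta> 1 * ?t) ^ (p - 1) * ?t"
    by (simp only: power_mult_distrib mult.assoc power_minus_mult[OF pos])
  also have "\<dots> = fps_X ^ (p - 1) + fps_X ^ p"
    by (simp only: th) (simp only: distrib_left mult_1_right power_minus_mult[OF pos])
  finally show ?thesis by (simp add: fps_freshman w_def)
qed

lemma xi_theta: "\<xi> oo \<theta> 1 = \<xi>"
proof -
  let ?t = "1 + fps_X :: 'k fps"
  have th: "\<theta> 1 * ?t = fps_X" using theta_mult[of "1::'k"] by simp
  have "(\<xi> oo \<theta> 1) * w = ((\<xi> * w) oo \<theta> 1) * ?t ^ p"
    using w_theta by (simp add: fps_compose_mult_distrib theta_0 mult.assoc)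
  also have "\<dots> = (\<theta> 1 * ?t) ^ p"
    by (simp add: xi_w fps_compose_power[symmetric] theta_0 fps_X_fps_compose_startby0 power_mult_distrib)
  also have "\<dots> = \<xi> * w" by (simp add: xi_w th)
  finally show ?thesis using w_nz by simp
qed

text \<open>If \<open>f - f(0)\<close> is nonzero, its order is positive and divisible by
  \<open>p\<close>, hence at least the order \<open>p\<close> of \<open>\<xi>\<close>; the quotient
  by the invariant \<open>\<xi>\<close> is again invariant.\<close>

lemma invariant_decompose:
  assumes "f oo \<theta> 1 = f"
  shows "\<exists>g. g oo \<theta> 1 = g \<and> f = fps_const (f $ 0) + \<xi> * g"
proof -
  define d where "d = f - fps_const (f $ 0)"
  have d: "d oo \<theta> 1 = d"
    using assms by (simp add: d_def fps_compose_sub_distrib)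
  have "fps_X ^ p dvd d"
  proof (cases "d = 0")
    case False
    with semi_invariant_subdegree[of d 0] d char have "p dvd subdegree d"
      by (simp add: mod_0_imp_dvd)
    moreover have "subdegree d > 0"
      using False by (auto simp: d_def subdegree_eq_0_iff intro!: Nat.gr0I)
    ultimately have "p \<le> subdegree d" by (simp add: dvd_imp_le)
    then have "d = fps_shift p d * fps_X ^ p" by (rule fps_shift_times_fps_X_power[symmetric])
    then show ?thesis by (metis dvd_triv_right)
  qed simp
  then obtain g' where g': "d = fps_X ^ p * g'" by (elim dvdE)
  define g where "g = w * g'"
  have dg: "d = \<xi> * g" by (simp add: g_def g' mult.assoc[symmetric] xi_w)
  then have "\<xi> * (g oo \<theta> 1) = \<xi> * g"
    using d by (simp add: fps_compose_mult_distrib theta_0 xi_theta)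
  then have "g oo \<theta> 1 = g" using xi_nz by simp
  then show ?thesis using dg by (intro exI[of _ g]) (simp add: d_def algebra_simps)
qed

text \<open>Iterating the decomposition yields the \<open>\<xi>\<close>-adic expansion of
  \<open>f\<close>; the series \<open>h\<close> collects the successive constant terms.\<close>

lemma invariant_is_compose_xi:
  assumes "f oo \<theta> 1 = f"
  shows "\<exists>h. f = h oo \<xi>"
proof -
  obtain g where g: "\<And>f. f oo \<theta> 1 = f \<Longrightarrow> g f oo \<theta> 1 = g f \<and> f = fps_const (f $ 0) + \<xi> * g f"
    using invariant_decompose by metis
  define F where "F k = (g ^^ k) f" for k
  have F_inv: "F k oo \<theta> 1 = F k" for k
    by (induction k) (simp_all add: F_def assms g)
  then have F_step: "F k = fps_const (F k $ 0) + \<xi> * F (Suc k)" for k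
    using g[of "F k"] by (simp add: F_def)
  define h where "h = Abs_fps (\<lambda>k. F k $ 0)"
  have F_eq: "F k - (fps_shift k h oo \<xi>) = \<xi> * (F (Suc k) - (fps_shift (Suc k) h oo \<xi>))" for k
  proof -
    have "fps_shift k h = fps_const (F k $ 0) + fps_X * fps_shift (Suc k) h"
    proof (rule fps_ext)
      show "fps_shift k h $ n = (fps_const (F k $ 0) + fps_X * fps_shift (Suc k) h) $ n" for n
        by (cases n) (simp_all add: h_def)
    qed
    then have "fps_shift k h oo \<xi> = fps_const (F k $ 0) + \<xi> * (fps_shift (Suc k) h oo \<xi>)"
      by (simp add: fps_compose_add_distrib fps_compose_mult_distrib xi_0 fps_X_fps_compose_startby0)
    then show ?thesis by (subst F_step) (simp add: algebra_simps)
  qed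
  \<comment> \<open>The difference is divisible by every power of \<open>\<xi>\<close>, hence
    zero.\<close>
  have "f - (h oo \<xi>) = \<xi> ^ k * (F k - (fps_shift k h oo \<xi>))" for k
  proof (induction k)
    case (Suc k) then show ?case using F_eq[of k] by (simp add: mult_ac)
  qed (simp add: F_def)
  moreover have "(\<xi> ^ Suc n * a) $ n = 0" for a n
  proof -
    have "\<xi> = fps_X * (fps_X ^ (p - 1) * inverse w)"
      using pos by (simp add: \<xi>_def mult.assoc[symmetric] flip: power_Suc)
    then have "\<xi> ^ Suc n * a = fps_X ^ Suc n * ((fps_X ^ (p - 1) * inverse w) ^ Suc n * a)"
      by (simp only: power_mult_distrib mult.assoc)
    then show ?thesis by (simp only: fps_X_power_mult_nth) simp
  qed
  ultimately have "f - (h oo \<xi>) = 0" by (intro fps_ext) (metis fps_zero_nth)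
  then show ?thesis by auto
qed

lemma shear_Psi: "shear 1 (\<Psi> F) = \<Psi> F"
proof (rule fps_ext)
  fix N
  define t :: "'k fps" where "t = 1 + fps_X"
  have th: "\<theta> 1 * t = fps_X" using theta_mult[of "1::'k"] by (simp add: t_def)
  have wt: "(w oo \<theta> 1) * t ^ p = w" using w_theta by (simp add: t_def)
  have "shear 1 (\<Psi> F) $ N = (\<Psi> F $ N oo \<theta> 1) * t ^ N" by (simp add: shear_nth t_def)
  also have "\<dots> = \<Psi> F $ N"
    unfolding Psi_nth fps_compose_sum_distrib sum_distrib_right
  proof (intro sum.cong refl)
    fix i assume i: "i \<in> {..N}"
    define j where "j = (N - i) div p"
    show "((if p dvd N - i then fps_X ^ i * w ^ ((N - i) div p) * (F $ i $ ((N - i) div p) oo \<xi>) else 0) oo \<theta> 1) * t ^ N =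
      (if p dvd N - i then fps_X ^ i * w ^ ((N - i) div p) * (F $ i $ ((N - i) div p) oo \<xi>) else 0)"
    proof (cases "p dvd N - i")
      case True
      then have N: "N = i + p * j" using i by (auto simp: j_def)
      have "((fps_X ^ i * w ^ j * (F $ i $ j oo \<xi>)) oo \<theta> 1) * t ^ N
        = (\<theta> 1 * t) ^ i * ((w oo \<theta> 1) * t ^ p) ^ j * (F $ i $ j oo \<xi>)"
        by (simp add: fps_compose_mult_distrib theta_0 fps_compose_power[symmetric] fps_X_fps_compose_startby0
            fps_compose_assoc[symmetric] xi_0 xi_theta N power_add power_mult_distrib mult_ac power_mult[symmetric])
      also have "\<dots> = fps_X ^ i * w ^ j * (F $ i $ j oo \<xi>)"
        by (simp add: th wt)
      finally show ?thesis by (simp only: True if_True j_def)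
    qed simp
  qed
  finally show "shear 1 (\<Psi> F) $ N = \<Psi> F $ N" .
qed

text \<open>For an invariant series, the coefficient of \<open>v^N\<close> with
  \<open>N = i + p j\<close> has weight \<open>N\<close>. Removing \<open>w^j\<close> leaves weight
  \<open>i\<close>, so its order, if it is nonzero, is congruent to \<open>i\<close> modulo
  \<open>p\<close>; removing \<open>u^i\<close> leaves an invariant, a series in
  \<open>\<xi>\<close>.\<close>

theorem range_Psi_shear: "range \<Psi> = {a. shear 1 a = a}"
proof (intro equalityI subsetI)
  fix a :: "'k ps2" assume "a \<in> {a. shear 1 a = a}"
  then have a: "(a $ N oo \<theta> 1) * (1 + fps_X) ^ N = a $ N" for N
    using shear_nth[of 1 a N] by simp
  show "a \<in> range \<Psi>"
  proof (rule range_Psi)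
    fix N
    define t :: "'k fps" where "t = 1 + fps_X"
    have th: "\<theta> 1 * t = fps_X" using theta_mult[of "1::'k"] by (simp add: t_def)
    have wt: "(w oo \<theta> 1) * t ^ p = w" using w_theta by (simp add: t_def)
    define i j where "i = N mod p" and "j = N div p"
    have N: "N = i + p * j" by (simp add: i_def j_def)
    define b where "b = a $ N * inverse w ^ j"
    have ab: "a $ N = w ^ j * b"
    proof -
      have "w ^ j * inverse w ^ j = 1"
        by (simp add: inverse_mult_eq_1' w_unit flip: power_mult_distrib)
      then show ?thesis by (simp add: b_def mult.left_commute[of "w ^ j"])
    qed
    have "w ^ j * ((b oo \<theta> 1) * t ^ i) = ((w oo \<theta> 1) * t ^ p) ^ j * ((b oo \<theta> 1) * t ^ i)"
      by (simp add: wt)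
    also have "\<dots> = (a $ N oo \<theta> 1) * t ^ N"
    proof -
      have "a $ N oo \<theta> 1 = (w oo \<theta> 1) ^ j * (b oo \<theta> 1)"
        by (simp add: ab fps_compose_mult_distrib theta_0 fps_compose_power)
      moreover have "t ^ N = t ^ i * (t ^ p) ^ j"
        by (simp add: N power_add power_mult)
      ultimately show ?thesis by (simp only: power_mult_distrib mult_ac)
    qed
    also have "\<dots> = w ^ j * b" using a[of N] ab by (simp add: t_def)
    finally have b: "(b oo \<theta> 1) * t ^ i = b" by (simp add: w_nz)
    have "fps_X ^ i dvd b"
    proof (cases "b = 0")
      case False
      then have "subdegree b mod p = i"
        using semi_invariant_subdegree[OF False b[unfolded t_def]] char by (simp add: i_def)
      then have "i \<le> subdegree b" by (metis mod_less_eq_dividend)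
      then have "b = fps_shift i b * fps_X ^ i" by (rule fps_shift_times_fps_X_power[symmetric])
      then show ?thesis by (metis dvd_triv_right)
    qed simp
    then obtain g where g: "b = fps_X ^ i * g" by (elim dvdE)
    have "fps_X ^ i * (g oo \<theta> 1) = (\<theta> 1 * t) ^ i * (g oo \<theta> 1)" by (simp add: th)
    also have "\<dots> = fps_X ^ i * g"
      using b by (simp add: g fps_compose_mult_distrib theta_0 fps_compose_power[symmetric]
          fps_X_fps_compose_startby0 power_mult_distrib mult_ac)
    finally have "g oo \<theta> 1 = g" by simp
    then obtain h where "g = h oo \<xi>" using invariant_is_compose_xi by blast
    then show "\<exists>h. a $ N = fps_X ^ (N mod p) * w ^ (N div p) * (h oo \<xi>)"
      using ab g by (intro exI[of _ h]) (simp add: i_def j_def)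
  qed
qed (auto simp: shear_Psi)

end

section \<open>Rational double points and presentations\<close>

lemma kalg_aut_carrier_iff:
  "\<sigma> \<in> carrier (kalg_aut :: ('k::field ps2 \<Rightarrow> 'k ps2) monoid) \<longleftrightarrow>
     bij \<sigma> \<and> (\<forall>a b. \<sigma> (a + b) = \<sigma> a + \<sigma> b) \<and> (\<forall>a b. \<sigma> (a * b) = \<sigma> a * \<sigma> b) \<and> (\<forall>c. \<sigma> (scalar2 c) = scalar2 c)"
proof -
  have "\<sigma> 1 = 1" if "\<forall>c. \<sigma> (scalar2 c) = scalar2 c"
    using that[rule_format, of 1] by (simp add: scalar2_def)
  then show ?thesis
    by (auto simp: kalg_aut_def ring_iso_def Ring.ring_hom_def ring_of_type_algebra_def)
qed

lemma kalg_aut_pow: "\<sigma> [^]\<^bsub>kalg_aut\<^esub> (n::nat) = \<sigma> ^^ n"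
  by (induction n) (simp_all add: kalg_aut_def nat_pow_def funpow_swap1 fun_eq_iff)

lemma fixed_by_generate_iff:
  assumes "\<sigma> \<in> carrier (kalg_aut :: ('k::field ps2 \<Rightarrow> 'k ps2) monoid)"
  shows "(\<forall>\<tau>\<in>generate kalg_aut {\<sigma>}. \<tau> a = a) \<longleftrightarrow> \<sigma> a = a"
proof
  interpret group "kalg_aut :: ('k ps2 \<Rightarrow> 'k ps2) monoid" by (rule group_kalg_aut)
  assume a: "\<sigma> a = a"
  have "\<tau> a = a" if "\<tau> \<in> generate kalg_aut {\<sigma>}" for \<tau>
    using that
  proof induction
    case (inv h)
    then have "(inv\<^bsub>kalg_aut\<^esub> \<sigma> \<circ> \<sigma>) a = a"
      using l_inv[OF assms] by (simp add: kalg_aut_def)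
    then show ?case using inv a by simp
  qed (use a in \<open>auto simp: kalg_aut_def\<close>)
  then show "\<forall>\<tau>\<in>generate kalg_aut {\<sigma>}. \<tau> a = a" by blast
qed (use generate.incl in fastforce)

lemma invariant_ring_carrier:
  assumes "\<sigma> \<in> carrier kalg_aut"
  shows "carrier (invariant_ring \<sigma>) = {a. \<sigma> a = a}"
  unfolding invariant_ring_def using fixed_by_generate_iff[OF assms] by simp

lemma rdp_A_ideal_eq:
  "rdp_A_ideal r = {Q * (z3 ^ (r + 1) - x3 * y3) | Q. True}"
  by (simp add: rdp_A_ideal_def cgenideal_def ring_of_type_algebra_def)

lemma rdp_A_ideal_is_ideal: "ideal (rdp_A_ideal r) PS3"
  unfolding rdp_A_ideal_def
  by (rule cring.cgenideal_ideal[OF cring_from_type_algebra]) (simp add: ring_of_type_algebra_def)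

definition rdp_coset :: "nat \<Rightarrow> 'k::field ps3 \<Rightarrow> 'k ps3 set"
  where "rdp_coset r F = rdp_A_ideal r +>\<^bsub>PS3\<^esub> F"

lemma rdp_coset_eq_iff:
  fixes F G :: "'k::field ps3"
  shows "rdp_coset r F = rdp_coset r G \<longleftrightarrow> (\<exists>Q. F - G = Q * (z3 ^ (r + 1) - x3 * y3))"
proof -
  define g :: "'k ps3" where "g = z3 ^ (r + 1) - x3 * y3"
  have coset: "rdp_coset r F = {Q * g + F | Q. True}" for F :: "'k ps3"
    unfolding rdp_coset_def g_def a_r_coset_def r_coset_def rdp_A_ideal_eq
    by (auto simp: ring_of_type_algebra_def)
  have "\<exists>Q. F - G = Q * g" if eq: "rdp_coset r F = rdp_coset r G"
  proof -
    have "F \<in> rdp_coset r F" unfolding coset by (auto intro!: exI[of _ 0])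
    then obtain Q where "F = Q * g + G" using eq unfolding coset by blast
    then show ?thesis by (intro exI[of _ Q]) simp
  qed
  moreover have "rdp_coset r F \<subseteq> rdp_coset r G" if "F - G = Q * g" for F G Q :: "'k ps3"
  proof -
    have "Q' * g + F = (Q' + Q) * g + G" for Q' using that by (simp add: algebra_simps)
    then show ?thesis unfolding coset by blast
  qed
  moreover have "G - F = (- Q) * g" if "F - G = Q * g" for Q
    using that by (simp add: algebra_simps)
  ultimately show ?thesis unfolding g_def by blast
qed

lemma rdp_coset_hom:
  "rdp_coset r (F + G) = rdp_coset r F \<oplus>\<^bsub>PS3 Quot rdp_A_ideal r\<^esub> rdp_coset r G"
  "rdp_coset r (F * G) = rdp_coset r F \<otimes>\<^bsub>PS3 Quot rdp_A_ideal r\<^esub> rdp_coset r G"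
  "rdp_coset r 1 = \<one>\<^bsub>PS3 Quot rdp_A_ideal r\<^esub>"
  using ring_hom_memE(2,3)[OF ideal.rcos_ring_hom[OF rdp_A_ideal_is_ideal[of r]], of F G]
    ring_hom_memE(4)[OF ideal.rcos_ring_hom[OF rdp_A_ideal_is_ideal[of r]]]
  by (simp_all add: rdp_coset_def ring_of_type_algebra_def)

lemma carrier_rdp_quotient: "carrier (PS3 Quot rdp_A_ideal r) = range (rdp_coset r)"
  by (auto simp: FactRing_def A_RCOSETS_def' rdp_coset_def ring_of_type_algebra_def)

text \<open>This unfolds an isomorphism with the quotient ring into a map between power series
  rings, so that later arguments compute with elements instead of cosets.\<close>

definition rdp_presentation :: "nat \<Rightarrow> ('k::field ps2 \<Rightarrow> 'k ps2) \<Rightarrow> ('k ps3 \<Rightarrow> 'k ps2) \<Rightarrow> bool"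
  where "rdp_presentation r \<sigma> \<psi> \<longleftrightarrow>
    (\<forall>F G. \<psi> (F + G) = \<psi> F + \<psi> G) \<and> (\<forall>F G. \<psi> (F * G) = \<psi> F * \<psi> G) \<and>
    (\<forall>c. \<psi> (scalar3 c) = scalar2 c) \<and> range \<psi> = {a. \<sigma> a = a} \<and>
    (\<forall>F. \<psi> F = 0 \<longleftrightarrow> (\<exists>Q. F = Q * (z3 ^ (r + 1) - x3 * y3)))"

lemma invariant_ring_ops:
  "a \<oplus>\<^bsub>invariant_ring \<sigma>\<^esub> b = a + b" "a \<otimes>\<^bsub>invariant_ring \<sigma>\<^esub> b = a * b" "\<one>\<^bsub>invariant_ring \<sigma>\<^esub> = 1"
  by (simp_all add: invariant_ring_def ring_of_type_algebra_def)

lemma rdp_presentation_imp_is_rdp_A: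
  assumes \<sigma>: "\<sigma> \<in> carrier kalg_aut" and \<psi>: "rdp_presentation r \<sigma> \<psi>"
  shows "is_rdp_A r scalar2 (invariant_ring \<sigma>)"
proof -
  have add: "\<psi> (F + G) = \<psi> F + \<psi> G" and mult: "\<psi> (F * G) = \<psi> F * \<psi> G"
    and scal: "\<psi> (scalar3 c) = scalar2 c" and ran: "range \<psi> = carrier (invariant_ring \<sigma>)"
    and ker: "\<psi> F = 0 \<longleftrightarrow> (\<exists>Q. F = Q * (z3 ^ (r + 1) - x3 * y3))" for F G c
    using \<psi> invariant_ring_carrier[OF \<sigma>] by (auto simp: rdp_presentation_def)
  have \<psi>1: "\<psi> 1 = 1" using scal[of 1] by (simp add: scalar3_def scalar2_def)
  have "\<psi> (F - G) = \<psi> F - \<psi> G" for F G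
    using add[of "F - G" G] by simp
  then have coset: "rdp_coset r F = rdp_coset r G \<longleftrightarrow> \<psi> F = \<psi> G" for F G
    unfolding rdp_coset_eq_iff ker[symmetric] by simp
  define \<phi> where "\<phi> b = rdp_coset r (inv_into UNIV \<psi> b)" for b
  have \<phi>: "\<phi> (\<psi> F) = rdp_coset r F" for F
    by (simp add: \<phi>_def coset f_inv_into_f)
  have "\<phi> \<in> Ring.ring_hom (invariant_ring \<sigma>) (PS3 Quot rdp_A_ideal r)"
    by (rule ring_hom_memI)
       (auto simp: ran[symmetric] invariant_ring_ops carrier_rdp_quotient \<phi> rdp_coset_hom[symmetric]
          simp flip: add mult \<psi>1)
  moreover have "bij_betw \<phi> (carrier (invariant_ring \<sigma>)) (carrier (PS3 Quot rdp_A_ideal r))"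
    unfolding bij_betw_def
    by (auto simp: inj_on_def ran[symmetric] \<phi> coset carrier_rdp_quotient image_image)
  moreover have "\<phi> (scalar2 c) = rdp_A_ideal r +>\<^bsub>PS3\<^esub> scalar3 c" for c
    using \<phi>[of "scalar3 c"] by (simp add: scal rdp_coset_def)
  ultimately show ?thesis
    unfolding is_rdp_A_def ring_iso_def by blast
qed

text \<open>The map \<open>\<psi>\<close> is the projection to the quotient followed by the inverse
  of the given isomorphism.\<close>

lemma is_rdp_A_imp_rdp_presentation:
  assumes \<sigma>: "\<sigma> \<in> carrier (kalg_aut :: ('k::field ps2 \<Rightarrow> 'k ps2) monoid)"
    and "is_rdp_A r scalar2 (invariant_ring \<sigma>)"
  shows "\<exists>\<psi>. rdp_presentation r \<sigma> \<psi>"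
proof -
  let ?R = "invariant_ring \<sigma>"
  obtain \<phi> where \<phi>: "\<phi> \<in> ring_iso ?R (PS3 Quot (rdp_A_ideal r :: 'k ps3 set))"
    and scal: "\<And>c. \<phi> (scalar2 c) = rdp_coset r (scalar3 c)"
    using assms(2) unfolding is_rdp_A_def rdp_coset_def by blast
  have R: "carrier ?R = {a. \<sigma> a = a}" by (rule invariant_ring_carrier[OF \<sigma>])
  have bij: "bij_betw \<phi> (carrier ?R) (range (rdp_coset r))"
    using \<phi> by (simp add: ring_iso_def carrier_rdp_quotient)
  have hom: "\<phi> \<in> Ring.ring_hom ?R (PS3 Quot rdp_A_ideal r)"
    using \<phi> by (simp add: ring_iso_def)
  define \<psi> where "\<psi> F = inv_into (carrier ?R) \<phi> (rdp_coset r F)" for F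
  have img: "rdp_coset r F \<in> \<phi> ` carrier ?R" for F
    using bij by (simp add: bij_betw_def)
  have in_R: "\<psi> F \<in> carrier ?R" and \<phi>\<psi>: "\<phi> (\<psi> F) = rdp_coset r F" for F
    unfolding \<psi>_def using img by (rule inv_into_into, rule f_inv_into_f)
  have \<psi>I: "\<psi> F = b" if "b \<in> carrier ?R" "\<phi> b = rdp_coset r F" for F b
    using that in_R[of F] \<phi>\<psi>[of F] bij by (auto simp: bij_betw_def inj_on_def)
  have closed: "a + b \<in> carrier ?R" "a * b \<in> carrier ?R" if "a \<in> carrier ?R" "b \<in> carrier ?R" for a b
    using that \<sigma> by (auto simp: R kalg_aut_carrier_iff)
  have scal_R: "scalar2 c \<in> carrier ?R" for c
    using \<sigma> by (auto simp: R kalg_aut_carrier_iff)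
  have "\<psi> (F + G) = \<psi> F + \<psi> G" for F G
    using ring_hom_memE(3)[OF hom in_R[of F] in_R[of G]] closed[OF in_R[of F] in_R[of G]]
    by (intro \<psi>I) (simp_all add: invariant_ring_ops \<phi>\<psi> rdp_coset_hom)
  moreover have "\<psi> (F * G) = \<psi> F * \<psi> G" for F G
    using ring_hom_memE(2)[OF hom in_R[of F] in_R[of G]] closed[OF in_R[of F] in_R[of G]]
    by (intro \<psi>I) (simp_all add: invariant_ring_ops \<phi>\<psi> rdp_coset_hom)
  moreover have \<psi>s: "\<psi> (scalar3 c) = scalar2 c" for c
    by (rule \<psi>I) (simp_all add: scal_R scal)
  moreover have "range \<psi> = {a. \<sigma> a = a}"
  proof -
    have "b \<in> range \<psi>" if b: "b \<in> carrier ?R" for b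
    proof -
      obtain F where "\<phi> b = rdp_coset r F"
        using bij_betwE[OF bij, rule_format, OF b] by (elim rangeE)
      then have "\<psi> F = b" by (rule \<psi>I[OF b])
      then show ?thesis by (rule range_eqI[OF sym])
    qed
    then have "carrier ?R \<subseteq> range \<psi>" by (rule subsetI)
    moreover have "range \<psi> \<subseteq> carrier ?R" by (rule image_subsetI, rule in_R)
    ultimately show ?thesis unfolding R[symmetric] by (intro equalityI)
  qed
  moreover have "\<psi> F = 0 \<longleftrightarrow> (\<exists>Q. F = Q * (z3 ^ (r + 1) - x3 * y3))" for F
  proof -
    have "\<psi> 0 = 0" using \<psi>s[of 0] by (simp add: scalar3_def scalar2_def)
    moreover have "\<psi> F = \<psi> 0 \<longleftrightarrow> rdp_coset r F = rdp_coset r 0"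
    proof
      assume "\<psi> F = \<psi> 0"
      then have "\<phi> (\<psi> F) = \<phi> (\<psi> 0)" by (rule arg_cong)
      then show "rdp_coset r F = rdp_coset r 0" by (simp only: \<phi>\<psi>)
    qed (simp only: \<psi>_def)
    ultimately have "\<psi> F = 0 \<longleftrightarrow> rdp_coset r F = rdp_coset r 0" by simp
    then show ?thesis unfolding rdp_coset_eq_iff by simp
  qed
  ultimately show ?thesis unfolding rdp_presentation_def by blast
qed

section \<open>The discriminant group\<close>

lemma dim_A_intersection_matrix [simp]:
  "dim_row (A_intersection_matrix r) = r" "dim_col (A_intersection_matrix r) = r"
  by (simp_all add: A_intersection_matrix_def)

lemma A_intersection_matrix_vec_nth:
  assumes "w \<in> carrier_vec r" "i < r"
  shows "vec_index (A_intersection_matrix r *\<^sub>v w) i =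
    (if i + 1 < r then vec_index w (i + 1) else 0) - 2 * vec_index w i + (if i > 0 then vec_index w (i - 1) else 0)"
proof -
  have "vec_index (A_intersection_matrix r *\<^sub>v w) i =
      (\<Sum>j=0..<r. (if i = j then -2 else if i = j + 1 \<or> j = i + 1 then 1 else 0) * vec_index w j)"
    using assms by (simp add: scalar_prod_def A_intersection_matrix_def)
  \<comment> \<open>At \<open>i = 0\<close> truncated subtraction gives \<open>i - 1 = 0\<close>;
    the inner guard removes the neighbour that does not exist.\<close>
  also have "\<dots> = (\<Sum>j=0..<r. (if j = i + 1 then vec_index w j else 0)) + (\<Sum>j=0..<r. if j = i then - 2 * vec_index w j else 0)
      + (\<Sum>j=0..<r. if j = i - 1 then (if i > 0 then vec_index w j else 0) else 0)"
    unfolding sum.distrib[symmetric]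
  proof (intro sum.cong refl)
    fix j
    consider "j = i" | "j = i + 1" | "i = j + 1" | "j \<noteq> i" "j \<noteq> i + 1" "i \<noteq> j + 1" by blast
    then show "(if i = j then -2 else if i = j + 1 \<or> j = i + 1 then 1 else 0) * vec_index w j =
        (if j = i + 1 then vec_index w j else 0) + (if j = i then - 2 * vec_index w j else 0) +
        (if j = i - 1 then if i > 0 then vec_index w j else 0 else 0)"
    proof cases
      case 1
      then show ?thesis by (cases i) simp_all
    next
      case 4
      then have "i = 0" if "j = i - 1" using that by linarith
      with 4 show ?thesis by simp
    qed simp_all
  qed
  also have "\<dots> = (if i + 1 < r then vec_index w (i + 1) else 0) - 2 * vec_index w i + (if i > 0 then vec_index w (i - 1) else 0)"
    using assms(2) by (simp add: sum.delta)
  finally show ?thesis .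
qed

text \<open>The image of the intersection matrix is the kernel of \<open>v \<mapsto> v\<^sub>1 + 2 v\<^sub>2 + \<dots> + r v\<^sub>r mod r + 1\<close>.\<close>
definition A_weight :: "nat \<Rightarrow> int vec \<Rightarrow> int"
  where "A_weight r v = (\<Sum>i<r. int (i + 1) * vec_index v i)"

text \<open>Summation by parts: the product is a second difference, which annihilates the linear
  weights up to boundary terms.\<close>

lemma A_weight_image:
  assumes w: "w \<in> carrier_vec r"
  shows "int (r + 1) dvd A_weight r (A_intersection_matrix r *\<^sub>v w)"
proof (cases r)
  case (Suc m)
  \<comment> \<open>Extension by zero supplies the missing neighbour at \<open>r\<close> and kills
    one boundary term.\<close>
  define W where "W j = (if j < r then vec_index w j else 0)" for j
  have "(\<Sum>i<n. int (i + 1) * (W (i + 1) - 2 * W i + (if i > 0 then W (i - 1) else 0))) =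
     int n * W n - int (n + 1) * (if n > 0 then W (n - 1) else 0)" for n
    by (induction n) (auto simp: algebra_simps)
  from this[of r] have "(\<Sum>i<r. int (i + 1) * (W (i + 1) - 2 * W i + (if i > 0 then W (i - 1) else 0)))
      = int (r + 1) * (- W m)" by (simp add: Suc W_def)
  moreover have "A_weight r (A_intersection_matrix r *\<^sub>v w) =
      (\<Sum>i<r. int (i + 1) * (W (i + 1) - 2 * W i + (if i > 0 then W (i - 1) else 0)))"
    unfolding A_weight_def
    by (intro sum.cong refl) (auto simp: A_intersection_matrix_vec_nth[OF w] W_def simp del: index_mult_mat_vec)
  ultimately have "A_weight r (A_intersection_matrix r *\<^sub>v w) = int (r + 1) * (- W m)"
    by (simp only:)
  then show ?thesis by (rule dvdI)
qed (simp add: A_weight_def)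

lemma A_weight_kernel:
  assumes v: "v \<in> carrier_vec r" and dvd: "int (r + 1) dvd A_weight r v"
  shows "\<exists>w \<in> carrier_vec r. v = A_intersection_matrix r *\<^sub>v w"
proof -
  \<comment> \<open>The double sum of \<open>v\<close>: its second difference is \<open>v\<close>,
    and it vanishes at 0.\<close>
  define S where "S i = (\<Sum>j<i. (int i - int j) * vec_index v j)" for i
  \<comment> \<open>The weights \<open>r - j\<close> and \<open>j + 1\<close> add up to
    \<open>r + 1\<close>.\<close>
  have "S r + A_weight r v = int (r + 1) * (\<Sum>j<r. vec_index v j)"
    unfolding S_def A_weight_def sum.distrib[symmetric] sum_distrib_left
    by (intro sum.cong refl) (simp add: algebra_simps)
  then have "S r = int (r + 1) * (\<Sum>j<r. vec_index v j) - A_weight r v" by simp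
  then have "int (r + 1) dvd S r" using dvd by simp
  then obtain t where t: "S r = int (r + 1) * t" by (elim dvdE)
  \<comment> \<open>The multiples of \<open>i + 1\<close> have second difference zero and vanish at
    the left end \<open>-1\<close>; subtracting this one enforces the right boundary value
    \<open>W r = 0\<close>.\<close>
  define W where "W i = S i - int (i + 1) * t" for i
  define T where "T i = (\<Sum>j<i. vec_index v j)" for i
  have S_Suc: "S (Suc i) = S i + T (Suc i)" for i
  proof -
    have "S (Suc i) = (\<Sum>j<Suc i. (int i - int j) * vec_index v j + vec_index v j)"
      unfolding S_def by (intro sum.cong refl) (simp add: algebra_simps)
    then show ?thesis by (simp add: sum.distrib S_def T_def)
  qed
  have W_rec: "W (i + 1) - 2 * W i + (if i > 0 then W (i - 1) else 0) = vec_index v i" for i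
  proof (cases i)
    case 0
    then show ?thesis by (simp add: W_def S_def)
  next
    case (Suc k)
    have "S (Suc (Suc k)) - 2 * S (Suc k) + S k = vec_index v (Suc k)"
      by (simp add: S_Suc T_def)
    then show ?thesis by (simp add: Suc W_def algebra_simps)
  qed
  have Wr: "W r = 0" by (simp add: W_def t)
  have "v = A_intersection_matrix r *\<^sub>v vec r W"
  proof (rule eq_vecI)
    fix i assume "i < dim_vec (A_intersection_matrix r *\<^sub>v vec r W)"
    then have i: "i < r" by simp
    have "i + 1 = r" if "\<not> i + 1 < r" using that i by simp
    then have "(if i + 1 < r then vec_index (vec r W) (i + 1) else 0) = W (i + 1)"
      using Wr by auto
    moreover have "(if i > 0 then vec_index (vec r W) (i - 1) else 0) = (if i > 0 then W (i - 1) else 0)"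
      using i by simp
    ultimately show "vec_index v i = vec_index (A_intersection_matrix r *\<^sub>v vec r W) i"
      using W_rec[of i] i
      by (simp only: A_intersection_matrix_vec_nth[OF vec_carrier i] index_vec)
  qed (use v in simp)
  then show ?thesis using vec_carrier by blast
qed

lemma A_weight_add:
  assumes "v \<in> carrier_vec r" "v' \<in> carrier_vec r"
  shows "A_weight r (v + v') = A_weight r v + A_weight r v'"
proof -
  have "dim_vec v' = r" using assms by simp
  then show ?thesis
    unfolding A_weight_def sum.distrib[symmetric]
    by (intro sum.cong refl) (simp add: distrib_left)
qed

text \<open>First isomorphism theorem for the weight modulo \<open>r + 1\<close>; multiples of the
  first basis vector, which has weight 1, give surjectivity.\<close>

theorem order_discriminant_group_A:
  assumes "r > 0"
  shows "Coset.order (discriminant_group (A_intersection_matrix r)) = r + 1"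
proof -
  let ?V = "monoid_vec TYPE(int) r" and ?C = "integer_mod_group (r + 1)"
  define h where "h v = A_weight r v mod int (r + 1)" for v
  have "h \<in> hom ?V ?C"
  proof (rule homI)
    fix v v' assume "v \<in> carrier ?V" "v' \<in> carrier ?V"
    then have "A_weight r (v + v') = A_weight r v + A_weight r v'"
      by (intro A_weight_add) (simp_all add: monoid_vec_simps)
    then show "h (v \<otimes>\<^bsub>?V\<^esub> v') = h v \<otimes>\<^bsub>?C\<^esub> h v'"
      unfolding h_def mult_integer_mod_group monoid_vec_simps by (simp only: mod_add_eq)
    show "h v \<in> carrier ?C"
      unfolding h_def carrier_integer_mod_group by simp
  qed
  then interpret group_hom ?V ?C h
    by (rule group_hom.intro[OF comm_group.axioms(2)[OF comm_group_vec] group_integer_mod_group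
          group_hom_axioms.intro])
  have ker: "kernel ?V ?C h = {A_intersection_matrix r *\<^sub>v w | w. w \<in> carrier_vec r}"
  proof -
    have "A_intersection_matrix r *\<^sub>v w \<in> carrier_vec r" for w
      by (rule carrier_vecI) simp
    moreover have "kernel ?V ?C h = {v \<in> carrier_vec r. int (r + 1) dvd A_weight r v}"
      by (simp add: kernel_def monoid_vec_simps h_def dvd_eq_mod_eq_0 del: of_nat_Suc of_nat_add)
    ultimately show ?thesis
      using A_weight_kernel[of _ r] A_weight_image[of _ r] by blast
  qed
  have "c \<in> h ` carrier ?V" if "c \<in> carrier ?C" for c
  proof
    have "A_weight r (vec r (\<lambda>i. if i = 0 then c else 0)) =
        (\<Sum>i<r. if i = 0 then c else 0)"
      unfolding A_weight_def by (intro sum.cong) auto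
    then show "c = h (vec r (\<lambda>i. if i = 0 then c else 0))"
      using assms that by (simp add: h_def carrier_integer_mod_group)
  qed (simp add: monoid_vec_simps)
  then have "h ` carrier ?V = carrier ?C" using hom_closed by blast
  then have "?V Mod kernel ?V ?C h \<cong> ?C" by (rule FactGroup_iso)
  then have "card (carrier (?V Mod kernel ?V ?C h)) = card (carrier ?C)" by (rule iso_same_card)
  then show ?thesis
    unfolding ker by (simp add: discriminant_group_def Coset.order_def carrier_integer_mod_group)
qed

section \<open>Traces and ramification for cyclic actions\<close>

text \<open>Stated for any commutative monoid, to give invariance of traces, norms and orbit
  polynomials alike.\<close>

lemma (in comm_monoid_set) lessThan_cyclic_shift:
  assumes "g n = g 0"
  shows "F (\<lambda>i. g (Suc i)) {..<n} = F g {..<n}"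
proof (cases n)
  case (Suc m)
  have "F (\<lambda>i. g (Suc i)) {..<n} = F (\<lambda>i. g (Suc i)) {..<m} \<^bold>* g 0"
    using assms by (simp add: Suc lessThan_Suc commute)
  also have "\<dots> = F g {..<n}"
    unfolding Suc lessThan_Suc_eq_insert_0 by (subst insert) (auto simp: reindex commute)
  finally show ?thesis .
qed simp

locale cyclic_action =
  fixes \<sigma> :: "'a::idom \<Rightarrow> 'a" and p :: nat
  assumes act_add: "\<sigma> (a + b) = \<sigma> a + \<sigma> b"
    and act_mult: "\<sigma> (a * b) = \<sigma> a * \<sigma> b"
    and act_1: "\<sigma> 1 = 1"
    and period: "(\<sigma> ^^ p) a = a"
    and p_pos: "p > 0"
begin

lemma act_0: "\<sigma> 0 = 0"
  using act_add[of 0 0] by (simp only: add_0_right add_cancel_right_right)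

lemma act_diff: "\<sigma> (a - b) = \<sigma> a - \<sigma> b"
  using act_add[of "a - b" b] by simp

lemma act_minus: "\<sigma> (- a) = - \<sigma> a"
  using act_diff[of 0 a] by (simp add: act_0)

lemma act_power: "\<sigma> (a ^ n) = \<sigma> a ^ n"
  by (induction n) (simp_all add: act_1 act_mult)

lemma act_sum: "\<sigma> (sum f S) = (\<Sum>i\<in>S. \<sigma> (f i))"
  by (induction S rule: infinite_finite_induct) (simp_all add: act_0 act_add)

lemma act_prod: "\<sigma> (prod f S) = (\<Prod>i\<in>S. \<sigma> (f i))"
  by (induction S rule: infinite_finite_induct) (simp_all add: act_1 act_mult)

lemma act_of_nat: "\<sigma> (of_nat n) = of_nat n"
  by (induction n) (simp_all add: act_0 act_1 act_add)

lemma act_funpow_add: "(\<sigma> ^^ i) (a + b) = (\<sigma> ^^ i) a + (\<sigma> ^^ i) b"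
  by (induction i) (simp_all add: act_add)

lemma act_funpow_mult: "(\<sigma> ^^ i) (a * b) = (\<sigma> ^^ i) a * (\<sigma> ^^ i) b"
  by (induction i) (simp_all add: act_mult)

lemma act_funpow_fixed: "\<sigma> a = a \<Longrightarrow> (\<sigma> ^^ i) a = a"
  by (induction i) simp_all

definition tr :: "'a \<Rightarrow> 'a" where "tr a = (\<Sum>i<p. (\<sigma> ^^ i) a)"
definition nm :: "'a \<Rightarrow> 'a" where "nm a = (\<Prod>i<p. (\<sigma> ^^ i) a)"

lemma act_tr: "\<sigma> (tr a) = tr a"
  using sum.lessThan_cyclic_shift[of "\<lambda>i. (\<sigma> ^^ i) a" p] period
  by (simp add: tr_def act_sum)

lemma act_nm: "\<sigma> (nm a) = nm a"
  using prod.lessThan_cyclic_shift[of "\<lambda>i. (\<sigma> ^^ i) a" p] period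
  by (simp add: nm_def act_prod)

lemma tr_add: "tr (a + b) = tr a + tr b"
  by (simp add: tr_def act_funpow_add sum.distrib)

lemma tr_fixed_mult: "\<sigma> b = b \<Longrightarrow> tr (a * b) = tr a * b"
  by (simp add: tr_def act_funpow_mult act_funpow_fixed sum_distrib_right)

lemma nm_fixed: "\<sigma> a = a \<Longrightarrow> nm a = a ^ p"
  by (simp add: nm_def act_funpow_fixed)

text \<open>The functions \<open>\<sigma>\<^sup>i \<mapsto> \<Sum>\<^sub>l c\<^sub>l \<sigma>\<^sup>i d\<^sub>l\<close> form the image of \<open>A \<otimes> A \<rightarrow> \<Prod>\<^sub>G A\<close>.\<close>
inductive_set galois_fun :: "(nat \<Rightarrow> 'a) set" where
  gen: "(\<lambda>i. c * (\<sigma> ^^ i) d) \<in> galois_fun"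
| add: "h \<in> galois_fun \<Longrightarrow> h' \<in> galois_fun \<Longrightarrow> (\<lambda>i. h i + h' i) \<in> galois_fun"

lemma galois_fun_gen_mult:
  assumes "h \<in> galois_fun"
  shows "(\<lambda>i. c * (\<sigma> ^^ i) d * h i) \<in> galois_fun"
  using assms
proof induction
  case (gen c' d')
  show ?case
    using galois_fun.gen[of "c * c'" "d * d'"] by (simp add: act_funpow_mult mult_ac)
qed (auto simp: distrib_left intro: galois_fun.add)

lemma galois_fun_mult:
  assumes "h \<in> galois_fun" "h' \<in> galois_fun"
  shows "(\<lambda>i. h i * h' i) \<in> galois_fun"
  using assms(1)
  by induction (auto simp: distrib_right intro: galois_fun.add galois_fun_gen_mult[OF assms(2)])

lemma galois_fun_const: "(\<lambda>_. c) \<in> galois_fun"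
proof -
  have "(\<sigma> ^^ i) 1 = 1" for i by (rule act_funpow_fixed[OF act_1])
  then show ?thesis using galois_fun.gen[of c 1] by simp
qed

text \<open>These values measure how far \<open>\<sigma> ^^ j\<close> can be separated from the
  identity. For \<open>j\<close> prime to \<open>p\<close> they will be seen to include the
  ramification ideal.\<close>

definition separating :: "nat \<Rightarrow> 'a set"
  where "separating j = {h 0 | h. h \<in> galois_fun \<and> h j = 0}"

lemma separating_add:
  assumes "a \<in> separating j" "b \<in> separating j"
  shows "a + b \<in> separating j"
proof -
  obtain h h' where "h \<in> galois_fun" "h' \<in> galois_fun" "h j = 0" "h' j = 0" "a = h 0" "b = h' 0"
    using assms unfolding separating_def by blast
  then show ?thesis
    unfolding separating_def by (intro CollectI exI[of _ "\<lambda>i. h i + h' i"]) (simp add: galois_fun.add)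
qed

lemma separating_mult:
  assumes "a \<in> separating j"
  shows "c * a \<in> separating j"
proof -
  obtain h where "h \<in> galois_fun" "h j = 0" "a = h 0"
    using assms unfolding separating_def by blast
  then show ?thesis
    unfolding separating_def
    by (intro CollectI exI[of _ "\<lambda>i. c * h i"]) (simp add: galois_fun_mult[OF galois_fun_const])
qed

lemma separating_0: "0 \<in> separating j"
  unfolding separating_def by (auto intro!: exI[of _ "\<lambda>i. 0"] galois_fun_const)

lemma separating_diff_funpow: "(\<sigma> ^^ j) a - a \<in> separating j"
proof -
  \<comment> \<open>This is the function of the tensor
    \<open>\<sigma>^j a \<otimes> 1 - 1 \<otimes> a\<close>.\<close>
  have "(\<lambda>i. (\<sigma> ^^ j) a + (- 1) * (\<sigma> ^^ i) a) \<in> galois_fun"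
    by (intro galois_fun.add galois_fun.gen galois_fun_const)
  then show ?thesis
    unfolding separating_def by (auto intro!: exI[of _ "\<lambda>i. (\<sigma> ^^ j) a + (- 1) * (\<sigma> ^^ i) a"])
qed

text \<open>As \<open>\<sigma> ^^ j\<close> generates the cyclic group, a difference for
  \<open>\<sigma> ^^ k\<close> telescopes into differences for \<open>\<sigma> ^^ j\<close>.\<close>

lemma separating_diff:
  assumes "coprime j p"
  shows "(\<sigma> ^^ k) a - a \<in> separating j"
proof -
  have "(\<sigma> ^^ (j * m)) a - a \<in> separating j" for m
  proof (induction m)
    case (Suc m)
    have "(\<sigma> ^^ (j * Suc m)) a - a =
        ((\<sigma> ^^ j) ((\<sigma> ^^ (j * m)) a) - (\<sigma> ^^ (j * m)) a) + ((\<sigma> ^^ (j * m)) a - a)"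
      by (simp add: funpow_add)
    then show ?case
      using separating_add separating_diff_funpow Suc.IH by metis
  qed (simp add: separating_0)
  moreover obtain x where "[j * x = 1] (mod p)"
    using cong_solve_coprime_nat[OF assms] by auto
  then have "[j * (x * k) = k] (mod p)"
    by (metis cong_scalar_right mult.assoc mult_1)
  then have "(\<sigma> ^^ (j * (x * k))) a = (\<sigma> ^^ k) a"
    using funpow_mod_eq[OF period] by (metis cong_def)
  ultimately show ?thesis by metis
qed

text \<open>Multiply, over all \<open>j\<close>, functions with value \<open>f\<close> at 0 that
  vanish at \<open>j\<close>.\<close>

lemma galois_fun_delta:
  assumes "\<And>j. 0 < j \<Longrightarrow> j < p \<Longrightarrow> f \<in> separating j"
  shows "\<exists>h \<in> galois_fun. h 0 = f ^ (p - 1) \<and> (\<forall>j. 0 < j \<and> j < p \<longrightarrow> h j = 0)"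
proof -
  have "\<exists>h \<in> galois_fun. h 0 = f ^ n \<and> (\<forall>j. 0 < j \<and> j \<le> n \<longrightarrow> h j = 0)" if "n < p" for n
    using that
  proof (induction n)
    case 0
    then show ?case using galois_fun_const[of 1] by (intro bexI[of _ "\<lambda>_. 1"]) auto
  next
    case (Suc n)
    then obtain h where h: "h \<in> galois_fun" "h 0 = f ^ n" "\<And>j. 0 < j \<Longrightarrow> j \<le> n \<Longrightarrow> h j = 0"
      by force
    obtain h' where h': "h' \<in> galois_fun" "h' 0 = f" "h' (Suc n) = 0"
      using assms[of "Suc n"] Suc.prems unfolding separating_def by auto
    show ?case
      by (intro bexI[of _ "\<lambda>i. h i * h' i"] conjI galois_fun_mult h(1) h'(1))
         (use h h' in \<open>auto simp: le_Suc_eq\<close>)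
  qed
  moreover have "p - 1 < p" using p_pos by simp
  ultimately obtain h where "h \<in> galois_fun" "h 0 = f ^ (p - 1)" "\<forall>j. 0 < j \<and> j \<le> p - 1 \<longrightarrow> h j = 0"
    by blast
  moreover have "j \<le> p - 1" if "j < p" for j using that by linarith
  ultimately show ?thesis by blast
qed

text \<open>The ideal generated by the traces, built one summand at a time to suit the induction for
  norms.\<close>

inductive_set trace_ideal :: "'a set" where
  zero: "0 \<in> trace_ideal"
| step: "f \<in> trace_ideal \<Longrightarrow> f + c * tr d \<in> trace_ideal"

lemma trace_ideal_add: "f \<in> trace_ideal \<Longrightarrow> g \<in> trace_ideal \<Longrightarrow> f + g \<in> trace_ideal"
  by (rotate_tac, induction rule: trace_ideal.induct)
     (auto simp: add.assoc[symmetric] intro: trace_ideal.intros)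

lemma sum_galois_fun:
  assumes "h \<in> galois_fun"
  shows "(\<Sum>i<p. h i) \<in> trace_ideal"
  using assms
proof induction
  case (gen c d)
  show ?case
    using trace_ideal.step[OF trace_ideal.zero, of c d] by (simp add: tr_def sum_distrib_left)
qed (simp add: sum.distrib trace_ideal_add)

lemma prod_add_mult: "\<exists>s. (\<Prod>i<n. x i + t * y i) = (\<Prod>i<n. x i) + t * (s::'a)" for x y :: "nat \<Rightarrow> 'a"
proof (induction n)
  case (Suc n)
  then obtain s where s: "(\<Prod>i<n. x i + t * y i) = (\<Prod>i<n. x i) + t * s" by blast
  show ?case
    by (rule exI[of _ "s * (x n + t * y n) + (\<Prod>i<n. x i) * y n"]) (simp add: s algebra_simps)
qed (auto intro: exI[of _ 0])

text \<open>Adding \<open>c * t\<close> with \<open>t = tr d\<close> changes the norm by some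
  \<open>t * s\<close>. Both norms and \<open>t\<close> are invariant, so \<open>s\<close> is
  invariant when \<open>t \<noteq> 0\<close>, and \<open>t * s = tr (d * s)\<close>.\<close>

lemma nm_trace_ideal:
  assumes "f \<in> trace_ideal"
  shows "nm f \<in> range tr"
  using assms
proof induction
  case zero
  have "nm 0 = 0" using p_pos nm_fixed[OF act_0] by simp
  moreover have "tr 0 = 0" by (simp add: tr_def act_funpow_fixed act_0)
  ultimately show ?case by (metis rangeI)
next
  case (step f c d)
  let ?t = "tr d"
  have "nm (f + c * ?t) = (\<Prod>i<p. (\<sigma> ^^ i) f + ?t * (\<sigma> ^^ i) c)"
    by (simp add: nm_def act_funpow_add act_funpow_mult act_funpow_fixed act_tr mult.commute)
  then obtain s where s: "nm (f + c * ?t) = nm f + ?t * s"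
    unfolding nm_def using prod_add_mult by metis
  obtain d' where d': "nm f = tr d'" using step.IH by blast
  show ?case
  proof (cases "?t = 0")
    case False
    have "nm f + ?t * s = \<sigma> (nm (f + c * ?t))"
      unfolding act_nm by (rule s[symmetric])
    also have "\<dots> = nm f + ?t * \<sigma> s" unfolding s by (simp add: act_nm act_add act_mult act_tr)
    finally have "s = \<sigma> s" using False by simp
    then have "\<sigma> s = s" by (rule sym)
    then have "nm (f + c * ?t) = tr (d' + d * s)"
      by (simp add: s d' tr_add tr_fixed_mult)
    then show ?thesis by simp
  qed (simp add: s d')
qed

text \<open>Summing a function concentrated at 0 puts \<open>f ^ (p - 1)\<close> into the trace
  ideal; taking its norm turns an ideal member into an actual trace.\<close>

lemma trace_eq_power:
  assumes "\<sigma> f = f" and "\<And>j. 0 < j \<Longrightarrow> j < p \<Longrightarrow> f \<in> separating j"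
  shows "\<exists>d. tr d = f ^ ((p - 1) * p)"
proof -
  obtain h where h: "h \<in> galois_fun" "h 0 = f ^ (p - 1)" "\<And>j. 0 < j \<Longrightarrow> j < p \<Longrightarrow> h j = 0"
    using galois_fun_delta[OF assms(2)] by blast
  have "(\<Sum>i<p. h i) = (\<Sum>i<p. if i = 0 then f ^ (p - 1) else 0)"
    using h by (intro sum.cong) auto
  also have "\<dots> = f ^ (p - 1)" using p_pos by simp
  finally have "f ^ (p - 1) \<in> trace_ideal" using sum_galois_fun[OF h(1)] by simp
  moreover have "\<sigma> (f ^ (p - 1)) = f ^ (p - 1)" by (simp add: act_power assms(1))
  ultimately show ?thesis
    using nm_trace_ideal nm_fixed by (metis imageE power_mult)
qed

text \<open>In characteristic \<open>p\<close> one has \<open>tr = (\<sigma> - 1)\<^sup>p\<^sup>-\<^sup>1\<close>; the witness is explicit.\<close>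
lemma tr_eq_act_diff:
  assumes "CHAR('a) = p"
  shows "\<exists>a. \<sigma> a = a + tr d"
proof -
  define B where "B = (\<Sum>i<p. of_nat i * (\<sigma> ^^ i) d)"
  have "\<sigma> B + tr d = \<sigma> B + \<sigma> (tr d)" by (simp only: act_tr)
  also have "\<dots> = (\<Sum>i<p. of_nat (Suc i) * (\<sigma> ^^ Suc i) d)"
    by (simp add: B_def act_sum act_mult act_of_nat tr_def algebra_simps sum.distrib)
  \<comment> \<open>Since \<open>of_nat p = 0\<close>, the summand at \<open>p\<close> agrees with
    that at 0 and the cyclic shift applies.\<close>
  also have "\<dots> = B"
    unfolding B_def using assms by (intro sum.lessThan_cyclic_shift) (simp flip: assms)
  finally have "\<sigma> (- B) = - B + tr d"
    by (simp add: act_minus algebra_simps)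
  then show ?thesis by blast
qed

section \<open>Integrality over the invariants by orbit polynomials\<close>

lemma act_char_poly:
  "\<sigma> (coeff (\<Prod>i<n. [:- e i, 1:]) j) = coeff (\<Prod>i<n. [:- \<sigma> (e i), 1:]) j"
  for n :: nat
proof (induction n arbitrary: j)
  case 0
  show ?case by (simp add: coeff_1 act_0 act_1)
next
  case (Suc n)
  then show ?case
    by (cases j) (simp_all add: mult.commute[of "prod _ _"] act_add act_mult act_minus act_diff)
qed

lemma char_poly_fixed:
  "\<sigma> (coeff (\<Prod>i<p. [:- (\<sigma> ^^ i) e, 1:]) j) = coeff (\<Prod>i<p. [:- (\<sigma> ^^ i) e, 1:]) j"
  using prod.lessThan_cyclic_shift[of "\<lambda>i. [:- (\<sigma> ^^ i) e, 1:]" p] period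
  by (simp add: act_char_poly)

text \<open>The orbit polynomial is monic of degree \<open>p\<close>, and its factor for
  \<open>i = 0\<close> vanishes at \<open>e\<close>.\<close>

lemma char_poly_root:
  "e ^ p = - (\<Sum>j<p. coeff (\<Prod>i<p. [:- (\<sigma> ^^ i) e, 1:]) j * e ^ j)"
proof -
  let ?P = "\<Prod>i<p. [:- (\<sigma> ^^ i) e, 1:]"
  have deg: "degree ?P = p" by (subst degree_prod_eq_sum_degree) auto
  have "lead_coeff ?P = 1" by (simp add: lead_coeff_prod)
  then have "poly ?P e = (\<Sum>j<p. coeff ?P j * e ^ j) + e ^ p"
    by (simp add: poly_altdef deg lessThan_Suc_atMost[symmetric])
  moreover have "poly ?P e = 0"
    using p_pos by (auto simp: poly_prod intro!: bexI[of _ 0])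
  ultimately show ?thesis by (simp add: eq_neg_iff_add_eq_0 add.commute)
qed

end

section \<open>Frobenius on the second local cohomology group\<close>

text \<open>Frobenius is additive, and the part of \<open>f\<close> beyond degree \<open>n\<close>
  has a \<open>p\<close>-th power that starts beyond \<open>n\<close>. The coefficients may lie in
  any domain of characteristic \<open>p\<close>, so that the formula applies to both variables of
  \<open>k[[u,v]]\<close> in turn.\<close>

lemma fps_power_CHAR_nth:
  fixes f :: "'a::idom fps"
  assumes "CHAR('a) = p" and "prime p"
  shows "(f ^ p) $ n = (if p dvd n then (f $ (n div p)) ^ p else 0)"
proof -
  have p0: "p > 0" using assms(2) prime_gt_0_nat by blast
  let ?S = "\<Sum>i\<le>n. fps_const (f $ i) * fps_X ^ i"
  have "f = ?S + fps_X ^ Suc n * fps_shift (Suc n) f"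
  proof (rule fps_ext)
    fix m
    have "(\<Sum>i\<le>n. (fps_const (f $ i) * fps_X ^ i) $ m) = (\<Sum>i\<le>n. if i = m then f $ m else 0)"
      by (intro sum.cong) auto
    also have "\<dots> = (if m \<le> n then f $ m else 0)" by simp
    finally show "f $ m = (?S + fps_X ^ Suc n * fps_shift (Suc n) f) $ m"
      by (simp add: fps_sum_nth fps_X_power_mult_nth del: power_Suc)
  qed
  then have "f ^ p = (?S + fps_X ^ Suc n * fps_shift (Suc n) f) ^ p" by simp
  also have "\<dots> = ?S ^ p + (fps_X ^ Suc n * fps_shift (Suc n) f) ^ p"
    by (rule freshmans_dream) (simp_all add: assms)
  also have "?S ^ p = (\<Sum>i\<le>n. (fps_const (f $ i) * fps_X ^ i) ^ p)"
    by (rule freshmans_dream_sum) (simp_all add: assms)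
  also have "\<dots> = (\<Sum>i\<le>n. fps_const ((f $ i) ^ p) * fps_X ^ (i * p))"
    by (simp add: power_mult_distrib fps_const_power power_mult)
  finally have "(f ^ p) $ n =
      (\<Sum>i\<le>n. (fps_const ((f $ i) ^ p) * fps_X ^ (i * p)) $ n) + ((fps_X ^ Suc n) ^ p * fps_shift (Suc n) f ^ p) $ n"
    by (simp add: fps_sum_nth power_mult_distrib power_mult del: power_Suc)
  also have "((fps_X ^ Suc n) ^ p * fps_shift (Suc n) f ^ p) $ n = 0"
  proof -
    have "n < Suc n * p" using mult_le_mono2[of 1 p "Suc n"] p0 by simp
    then show ?thesis by (simp only: power_mult[symmetric] fps_X_power_mult_nth if_True)
  qed
  also have "(\<Sum>i\<le>n. (fps_const ((f $ i) ^ p) * fps_X ^ (i * p)) $ n) =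
      (\<Sum>i\<le>n. if i = n div p then (if p dvd n then (f $ i) ^ p else 0) else 0)"
    using p0 by (intro sum.cong refl) auto
  also have "\<dots> = (if p dvd n then (f $ (n div p)) ^ p else 0)"
    by simp
  finally show ?thesis by simp
qed

lemma u2_power_mult_nth: "(u2 ^ m * a) $ j $ i = (if i < m then 0 else a $ j $ (i - m))"
  by (simp add: u2_def fps_const_power fps_X_power_mult_nth)

lemma v2_power_mult_nth: "(v2 ^ m * a) $ j = (if j < m then 0 else a $ (j - m))"
  by (simp add: v2_def fps_X_power_mult_nth)

text \<open>Infinite descent: a coefficient at distance \<open>d\<close> from the bound \<open>q\<close> is the \<open>p\<close>-th power of
  one at distance \<open>d / p\<close>.\<close>
lemma frobenius_fixed_vanishes:
  fixes g :: "'k::field ps2"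
  assumes char: "CHAR('k) = p" and p: "prime p"
    and eq: "g ^ p = v2 ^ (p * q) * \<alpha> - u2 ^ (p * q) * \<beta> + (u2 * v2) ^ (q * (p - 1)) * g"
    and "s < q" "t < q"
  shows "g $ t $ s = 0"
  using \<open>s < q\<close> \<open>t < q\<close>
proof (induction "q - s" arbitrary: s t rule: less_induct)
  case less
  have p1: "p > 1" using p prime_gt_1_nat by blast
  have pq: "p * q = q * (p - 1) + q" using p1 by (cases p) (simp_all add: algebra_simps)
  \<comment> \<open>The shift matches the factor \<open>(u2 * v2) ^ (q * (p - 1))\<close>; both
    shifted exponents stay below \<open>p * q\<close>, so the other two terms vanish there.\<close>
  let ?s = "s + q * (p - 1)" and ?t = "t + q * (p - 1)"
  have "((u2 * v2) ^ (q * (p - 1)) * g) $ ?t $ ?s = g $ t $ s"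
    by (simp add: power_mult_distrib mult.assoc u2_power_mult_nth v2_power_mult_nth)
  moreover have "(v2 ^ (p * q) * \<alpha>) $ ?t $ ?s = 0" "(u2 ^ (p * q) * \<beta>) $ ?t $ ?s = 0"
    using less.prems by (simp_all add: u2_power_mult_nth v2_power_mult_nth pq)
  ultimately have eq': "g $ t $ s = (g ^ p) $ ?t $ ?s" using eq by simp
  show ?case
  proof (cases "p dvd ?t \<and> p dvd ?s")
    case True
    then obtain s' t' where s': "?s = p * s'" and t': "?t = p * t'" by (elim conjE dvdE)
    have "p * s' < p * q" "p * t' < p * q" using less.prems s' t' pq by linarith+
    then have lt: "s' < q" "t' < q" using p1 by simp_all
    have "p * (q - s') = q - s" unfolding diff_mult_distrib2 using s' pq by linarith
    moreover have "1 * (q - s') < p * (q - s')" using lt p1 by (intro mult_strict_right_mono) simp_all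
    ultimately have "q - s' < q - s" by simp
    then have "g $ t' $ s' = 0" using less.hyps lt by blast
    moreover have "(g ^ p) $ ?t $ ?s = (g $ t' $ s') ^ p"
      unfolding s' t' using p1 by (simp add: fps_power_CHAR_nth char p)
    ultimately show ?thesis using eq' p1 by simp
  next
    case False
    then have "(g ^ p) $ ?t $ ?s = 0"
      by (auto simp: fps_power_CHAR_nth char p)
    then show ?thesis using eq' by simp
  qed
qed

text \<open>The hypothesis says that the local cohomology class of \<open>C / (x\<^sup>n y\<^sup>n)\<close> is fixed by Frobenius.\<close>
theorem frobenius_fixed_class:
  fixes C :: "'k::field ps3"
  assumes char: "CHAR('k) = p" and p: "prime p"
    and eq: "C ^ p - y3 ^ (n * p) * A + x3 ^ (n * p) * B - (x3 * y3) ^ (n * (p - 1)) * C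
      = Q * (z3 ^ p - x3 * y3)"
  shows "\<exists>F G Q. C = x3 ^ n * F + y3 ^ n * G + Q * (z3 ^ p - x3 * y3)"
proof -
  have p0: "p > 0" using p prime_gt_0_nat by blast
  \<comment> \<open>The choice \<open>w = 1\<close> embeds the quotient ring by
    \<open>x = u^p\<close>, \<open>y = v^p\<close>, \<open>z = u v\<close>, whatever the action, so
    that degrees are visible as exponents.\<close>
  interpret monomial_model p "1 :: 'k fps"
    using p0 by unfold_locales auto
  have xi: "\<xi> = fps_X ^ p" by (simp add: \<xi>_def)
  have x: "\<Psi> x3 = u2 ^ p" and y: "\<Psi> y3 = v2 ^ p"
    by (simp_all add: Psi_x Psi_y xi u2_def v2_def fps_const_power)
  have "\<Psi> (C ^ p - y3 ^ (n * p) * A + x3 ^ (n * p) * B - (x3 * y3) ^ (n * (p - 1)) * C) = 0"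
    unfolding eq by (simp add: Psi_mult Psi_relation)
  then have eq': "\<Psi> C ^ p = v2 ^ (p * (n * p)) * \<Psi> A - u2 ^ (p * (n * p)) * \<Psi> B
      + (u2 * v2) ^ (n * p * (p - 1)) * \<Psi> C"
    by (simp add: Psi_minus Psi_add Psi_mult Psi_power x y power_mult_distrib mult_ac
        flip: power_mult) (simp add: algebra_simps)
  obtain Q' R where QR: "C = Q' * (z3 ^ p - x3 * y3) + R" and R: "\<And>i. i \<ge> p \<Longrightarrow> R $ i = 0"
    using weierstrass_division[OF p0] by blast
  have CR: "\<Psi> C = \<Psi> R" by (simp add: QR Psi_add Psi_mult Psi_relation)
  \<comment> \<open>For \<open>i < p\<close> this coefficient sits at
    \<open>u^(i + p l) v^(i + p j)\<close>, with both exponents below \<open>n * p\<close>, where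
    \<open>\<Psi> C\<close> vanishes.\<close>
  have R0: "R $ i $ j $ l = 0" if "j < n" "l < n" for i j l
  proof (cases "i < p")
    case True
    have lt: "i + p * m < n * p" if "m < n" for m
    proof -
      have "i + p * m < p * Suc m" using True by simp
      also have "\<dots> \<le> p * n" using that by (intro mult_le_mono2) simp
      finally show ?thesis by (simp add: mult.commute)
    qed
    have "\<Psi> R $ (i + p * j) $ (i + p * l) = 0"
      using frobenius_fixed_vanishes[OF char p eq'] lt that by (simp add: CR)
    moreover have "\<Psi> R $ (i + p * j) = fps_X ^ i * (R $ i $ j oo fps_X ^ p)"
      using True by (simp add: Psi_remainder_nth[OF R] xi)
    ultimately show ?thesis
      using p0 by (simp add: fps_X_power_mult_nth fps_nth_compose_X_power)
  qed (simp add: R)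
  \<comment> \<open>Terms with \<open>y\<close>-exponent below \<open>n\<close> are divisible by
    \<open>x3 ^ n\<close>, the others by \<open>y3 ^ n\<close>.\<close>
  define F where "F = Abs_fps (\<lambda>i. Abs_fps (\<lambda>j. if j < n then fps_shift n (R $ i $ j) else 0))"
  define G where "G = Abs_fps (\<lambda>i. fps_shift n (R $ i))"
  have xn: "(x3 ^ n * F) $ i $ j = fps_X ^ n * F $ i $ j" for i j
    by (simp add: x3_def fps_const_power)
  have yn: "(y3 ^ n * G) $ i = fps_X ^ n * G $ i" for i
    by (simp add: y3_def fps_const_power)
  have "R = x3 ^ n * F + y3 ^ n * G"
  proof (intro fps_ext)
    fix i j l
    show "R $ i $ j $ l = (x3 ^ n * F + y3 ^ n * G) $ i $ j $ l"
      by (simp add: xn yn fps_X_power_mult_nth) (simp add: F_def G_def R0)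
  qed
  then show ?thesis using QR by (intro exI[of _ F] exI[of _ G] exI[of _ Q']) (simp add: algebra_simps)
qed

section \<open>Ramification of actions with quotient of type \<open>A\<^sub>p\<^sub>-\<^sub>1\<close>\<close>

lemma ps2_mult_eq_1:
  fixes a :: "'k::field ps2"
  assumes "a $ 0 $ 0 \<noteq> 0"
  shows "\<exists>b. a * b = 1"
proof -
  have "a $ 0 * inverse (a $ 0) = 1"
    using assms by (rule inverse_mult_eq_1')
  then show ?thesis using fps_right_inverse by blast
qed

lemma ps2_decompose:
  fixes a :: "'k::field ps2"
  shows "\<exists>b c. a = scalar2 (a $ 0 $ 0) + (b * u2 + c * v2)"
proof -
  have "a = fps_const (a $ 0) + fps_X * fps_shift 1 a"
    by (rule fps_ext) (auto simp: fps_X_mult_nth)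
  moreover have "a $ 0 = fps_const (a $ 0 $ 0) + fps_X * fps_shift 1 (a $ 0)"
    by (rule fps_ext) (auto simp: fps_X_mult_nth)
  then have "fps_const (a $ 0) = scalar2 (a $ 0 $ 0) + u2 * fps_const (fps_shift 1 (a $ 0))"
    unfolding scalar2_def u2_def by (metis fps_const_add fps_const_mult)
  ultimately show ?thesis
    by (intro exI[of _ "fps_const (fps_shift 1 (a $ 0))"] exI[of _ "fps_shift 1 a"])
       (simp add: v2_def mult.commute add.assoc)
qed

lemma ps3_decompose:
  fixes F :: "'k::field ps3"
  assumes "F $ 0 $ 0 $ 0 = 0"
  shows "\<exists>F1 F2 F3. F = x3 * F1 + y3 * F2 + z3 * F3"
proof -
  have F: "F = fps_const (F $ 0) + z3 * fps_shift 1 F"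
    by (rule fps_ext) (auto simp: fps_X_mult_nth z3_def)
  have "F $ 0 = fps_const (F $ 0 $ 0) + fps_X * fps_shift 1 (F $ 0)"
    by (rule fps_ext) (auto simp: fps_X_mult_nth)
  then have F0: "fps_const (F $ 0) = fps_const (fps_const (F $ 0 $ 0)) + y3 * fps_const (fps_shift 1 (F $ 0))"
    unfolding y3_def by (metis fps_const_add fps_const_mult)
  have "F $ 0 $ 0 = fps_X * fps_shift 1 (F $ 0 $ 0)"
    by (rule fps_ext) (auto simp: fps_X_mult_nth assms)
  then have "fps_const (fps_const (F $ 0 $ 0)) = x3 * fps_const (fps_const (fps_shift 1 (F $ 0 $ 0)))"
    unfolding x3_def by (metis fps_const_mult)
  with F F0 show ?thesis by metis
qed

lemma u2_v2_regular:
  fixes h1 h2 :: "'k::field ps2"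
  assumes "h1 * v2 ^ m = h2 * u2 ^ m"
  shows "\<exists>h. h1 = h * u2 ^ m"
proof -
  have "h1 = fps_shift m h2 * u2 ^ m"
  proof (rule fps_ext)
    fix n
    have "(h1 * v2 ^ m) $ (n + m) = (h2 * u2 ^ m) $ (n + m)" using assms by simp
    then show "h1 $ n = (fps_shift m h2 * u2 ^ m) $ n"
      by (simp add: v2_def u2_def fps_const_power fps_X_power_mult_right_nth)
  qed
  then show ?thesis by blast
qed

text \<open>The ideal of \<open>x\<close> and \<open>y\<close> contains \<open>u2 ^ m\<close> and
  \<open>v2 ^ m\<close>, whose products with \<open>f\<close> are therefore multiples of
  \<open>x\<close>. Cancelling \<open>x\<close> in the cross product reduces the claim to the
  regularity of \<open>u2 ^ m\<close>, \<open>v2 ^ m\<close>.\<close>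

lemma parameters_regular:
  fixes x y f g :: "'k::field ps2"
  assumes "x \<noteq> 0" and "u2 ^ m = \<alpha> * x + \<beta> * y" and "v2 ^ m = \<alpha>' * x + \<beta>' * y"
    and "y * f = x * g"
  shows "\<exists>h. f = x * h"
proof -
  have u: "f * u2 ^ m = x * (\<alpha> * f + \<beta> * g)"
    using assms(2,4) by (simp add: algebra_simps)
  have v: "f * v2 ^ m = x * (\<alpha>' * f + \<beta>' * g)"
    using assms(3,4) by (simp add: algebra_simps)
  have "x * ((\<alpha> * f + \<beta> * g) * v2 ^ m) = f * u2 ^ m * v2 ^ m"
    by (simp only: u mult.assoc)
  also have "\<dots> = f * v2 ^ m * u2 ^ m"
    by (simp only: mult_ac)
  also have "\<dots> = x * ((\<alpha>' * f + \<beta>' * g) * u2 ^ m)"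
    by (simp only: v mult.assoc)
  finally have "(\<alpha> * f + \<beta> * g) * v2 ^ m = (\<alpha>' * f + \<beta>' * g) * u2 ^ m"
    using assms(1) by simp
  then obtain h where "\<alpha> * f + \<beta> * g = h * u2 ^ m" using u2_v2_regular by blast
  then have "f * u2 ^ m = (x * h) * u2 ^ m" using u by (simp add: mult.assoc)
  moreover have "u2 ^ m \<noteq> (0 :: 'k ps2)" by (simp add: u2_def)
  ultimately show ?thesis by auto
qed

lemma maximal_subset_Idl:
  assumes "a $ 0 $ 0 = 0"
  shows "a \<in> Idl\<^bsub>PS2\<^esub> {u2, v2 :: 'k::field ps2}"
proof -
  interpret R: ring "PS2 :: 'k ps2 ring" by (rule ring_from_type_algebra)
  let ?I = "Idl\<^bsub>PS2\<^esub> {u2, v2 :: 'k ps2}"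
  have sub: "{u2, v2 :: 'k ps2} \<subseteq> carrier PS2" by (simp add: ring_of_type_algebra_def)
  interpret I: ideal ?I PS2 by (rule R.genideal_ideal[OF sub])
  have gen: "u2 \<in> ?I" "v2 \<in> ?I" using R.genideal_self[OF sub] by auto
  have closed: "f + g \<in> ?I" if "f \<in> ?I" "g \<in> ?I" for f g
    using I.a_closed[OF that] by (simp add: ring_of_type_algebra_def)
  have absorb: "f * g \<in> ?I" if "g \<in> ?I" for f g
    using I.I_l_closed[OF that, of f] by (simp add: ring_of_type_algebra_def)
  obtain b c where "a = scalar2 (a $ 0 $ 0) + (b * u2 + c * v2)"
    using ps2_decompose by blast
  then have "a = b * u2 + c * v2" using assms by (simp add: scalar2_def)
  then show ?thesis using closed absorb gen by simp
qed

section \<open>Actions whose invariant ring is of type \<open>A_(p-1)\<close>\<close>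

locale rdp_action =
  fixes p :: nat and \<sigma> :: "'k::field ps2 \<Rightarrow> 'k ps2" and \<psi> :: "'k ps3 \<Rightarrow> 'k ps2"
  assumes char: "CHAR('k) = p" and p_gt_0: "p > 0"
    and aut: "\<sigma> \<in> carrier kalg_aut"
    and aut_period: "\<And>a. (\<sigma> ^^ p) a = a"
    and presentation: "rdp_presentation (p - 1) \<sigma> \<psi>"
begin

lemma prime_p: "prime p" using prime_CHAR_field char p_gt_0 by blast

sublocale cyclic_action \<sigma> p
proof
  show "\<sigma> 1 = 1"
    using aut by (metis fps_const_1_eq_1 kalg_aut_carrier_iff scalar2_def)
qed (use aut aut_period p_gt_0 in \<open>auto simp: kalg_aut_carrier_iff\<close>)

lemma act_scalar: "\<sigma> (scalar2 c) = scalar2 c"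
  using aut by (simp add: kalg_aut_carrier_iff)

text \<open>If \<open>\<sigma> a\<close> were a unit, a preimage of its inverse would be an inverse
  of \<open>a\<close>.\<close>

lemma act_maximal:
  assumes "a $ 0 $ 0 = 0"
  shows "\<sigma> a $ 0 $ 0 = 0"
proof (rule ccontr)
  assume "\<sigma> a $ 0 $ 0 \<noteq> 0"
  then obtain b where "\<sigma> a * b = 1" using ps2_mult_eq_1 by blast
  moreover obtain c where "b = \<sigma> c"
    using aut by (metis bij_pointE kalg_aut_carrier_iff)
  ultimately have "\<sigma> (a * c) = \<sigma> 1" by (simp add: act_mult act_1)
  then have "a * c = 1"
    using aut by (metis bij_pointE kalg_aut_carrier_iff)
  then have "(a * c) $ 0 $ 0 = 1" by simp
  with assms show False by simp
qed

text \<open>The scalars are fixed and represent all residue classes.\<close>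

lemma act_residue: "\<sigma> a $ 0 $ 0 = a $ 0 $ 0"
proof -
  have "\<sigma> (a - scalar2 (a $ 0 $ 0)) $ 0 $ 0 = 0"
    by (rule act_maximal) (simp add: scalar2_def)
  then show ?thesis by (simp add: act_diff act_scalar) (simp add: scalar2_def)
qed

lemma pres_add: "\<psi> (F + G) = \<psi> F + \<psi> G"
  and pres_mult: "\<psi> (F * G) = \<psi> F * \<psi> G"
  and pres_scalar: "\<psi> (scalar3 c) = scalar2 c"
  and pres_range: "range \<psi> = {a. \<sigma> a = a}"
  and pres_ker: "\<psi> F = 0 \<longleftrightarrow> (\<exists>Q. F = Q * (z3 ^ p - x3 * y3))"
  using presentation p_gt_0 by (simp_all add: rdp_presentation_def)

lemma pres_diff: "\<psi> (F - G) = \<psi> F - \<psi> G"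
  using pres_add[of "F - G" G] by simp

lemma pres_1: "\<psi> 1 = 1"
  using pres_scalar[of 1] by (simp add: scalar3_def scalar2_def)

lemma pres_power: "\<psi> (F ^ n) = \<psi> F ^ n"
  by (induction n) (simp_all add: pres_1 pres_mult)

lemma pres_fixed: "\<sigma> (\<psi> F) = \<psi> F"
  using pres_range by blast

lemma relation_nth_0: "(z3 ^ p - x3 * y3 :: 'k ps3) $ 0 $ 0 = 0"
  using p_gt_0 by (simp add: z3_def x3_def y3_def)

lemma pres_relation: "\<psi> z3 ^ p = \<psi> x3 * \<psi> y3"
proof -
  have "\<psi> (z3 ^ p - x3 * y3) = 0" unfolding pres_ker by (intro exI[of _ 1]) simp
  then show ?thesis by (simp add: pres_diff pres_mult pres_power)
qed

text \<open>If \<open>\<psi> F'\<close> with \<open>F'\<close> in the maximal ideal were a unit, its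
  inverse would be invariant and thus equal to some \<open>\<psi> G\<close>; but
  \<open>F' * G - 1\<close> is then a unit and cannot be a multiple of the relation.\<close>

lemma pres_residue: "\<psi> F $ 0 $ 0 = F $ 0 $ 0 $ 0"
proof -
  define F' where "F' = F - scalar3 (F $ 0 $ 0 $ 0)"
  have F': "F' $ 0 $ 0 $ 0 = 0" by (simp add: F'_def scalar3_def)
  have "\<psi> F' $ 0 $ 0 = 0"
  proof (rule ccontr)
    assume "\<psi> F' $ 0 $ 0 \<noteq> 0"
    then obtain b where b: "\<psi> F' * b = 1" using ps2_mult_eq_1 by blast
    have "\<psi> F' * \<sigma> b = \<sigma> (\<psi> F' * b)" by (simp add: act_mult pres_fixed)
    also have "\<dots> = \<psi> F' * b" by (simp only: b act_1)
    finally have "\<psi> F' * \<sigma> b = \<psi> F' * b" .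
    moreover have "\<psi> F' \<noteq> 0" using b by auto
    ultimately have "\<sigma> b = b" by simp
    then obtain G where "b = \<psi> G" using pres_range by blast
    then have "\<psi> (F' * G - 1) = 0" using b by (simp add: pres_diff pres_mult pres_1)
    then obtain Q where "F' * G - 1 = Q * (z3 ^ p - x3 * y3)" unfolding pres_ker by blast
    then have "(F' * G - 1) $ 0 $ 0 $ 0 = (Q * (z3 ^ p - x3 * y3)) $ 0 $ 0 $ 0" by simp
    also have "\<dots> = 0" by (simp only: fps_mult_nth_0 relation_nth_0 mult_zero_right fps_zero_nth)
    finally show False by (simp add: F')
  qed
  then show ?thesis
    by (simp add: F'_def pres_diff pres_scalar) (simp add: scalar2_def)
qed

lemma freshman: "((a::'k ps2) + b) ^ (p ^ n) = a ^ (p ^ n) + b ^ (p ^ n)"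
  by (rule freshmans_dream') (simp_all add: char prime_p)

lemma freshman_p: "((a::'k ps2) + b) ^ p = a ^ p + b ^ p"
  using freshman[of a b 1] by simp

definition xA where "xA = \<psi> x3"
definition yA where "yA = \<psi> y3"

lemma xyA_fixed: "\<sigma> xA = xA" "\<sigma> yA = yA"
  by (simp_all add: xA_def yA_def pres_fixed)

text \<open>The kernel of \<open>\<psi>\<close> is also that of the monomial substitution with
  \<open>w = 1\<close>, which maps \<open>x3\<close> to \<open>u^p\<close>.\<close>

lemma xA_nonzero: "xA \<noteq> 0"
proof
  interpret M: monomial_model p "1 :: 'k fps"
    using p_gt_0 by unfold_locales auto
  assume "xA = 0"
  then have "M.\<Psi> x3 = 0" unfolding xA_def pres_ker M.Psi_eq_0_iff .
  then have "M.\<xi> = 0" unfolding M.Psi_x by simp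
  then show False using M.xi_nz by simp
qed

lemma fixed_maximal_in_ideal:
  assumes "\<sigma> b = b" "b $ 0 $ 0 = 0"
  shows "\<exists>\<alpha> \<beta> \<gamma>. b = \<alpha> * xA + \<beta> * yA + \<gamma> * \<psi> z3"
proof -
  obtain F where F: "b = \<psi> F" using assms(1) pres_range by blast
  then obtain F1 F2 F3 where "F = x3 * F1 + y3 * F2 + z3 * F3"
    using ps3_decompose assms(2) pres_residue by metis
  then show ?thesis
    unfolding F xA_def yA_def
    by (intro exI[of _ "\<psi> F1"] exI[of _ "\<psi> F2"] exI[of _ "\<psi> F3"]) (simp add: pres_add pres_mult mult.commute)
qed

lemma char_poly_residue:
  assumes "\<And>i. e i $ 0 $ 0 = 0" and "j < n"
  shows "coeff (\<Prod>i<n. [:- e i, 1:]) j $ 0 $ 0 = (0 :: 'k)"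
  using assms(2)
proof (induction n arbitrary: j)
  case (Suc n)
  then show ?case
    by (cases j) (auto simp: mult.commute[of "prod _ _"] assms(1))
qed simp

text \<open>All lower coefficients of the orbit polynomial of \<open>e\<close> are invariants with
  residue zero, hence combinations of \<open>xA\<close>, \<open>yA\<close> and
  \<open>\<psi> z3\<close>.\<close>

lemma maximal_power_in_ideal:
  assumes "e $ 0 $ 0 = 0"
  shows "\<exists>\<alpha> \<beta> \<gamma>. e ^ p = \<alpha> * xA + \<beta> * yA + \<gamma> * \<psi> z3"
proof -
  define c where "c j = coeff (\<Prod>i<p. [:- (\<sigma> ^^ i) e, 1:]) j" for j
  have "(\<sigma> ^^ i) e $ 0 $ 0 = 0" for i
    by (induction i) (simp_all add: assms act_residue)
  then have "c j $ 0 $ 0 = 0" if "j < p" for j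
    unfolding c_def using that by (rule char_poly_residue)
  moreover have "\<sigma> (c j) = c j" for j
    unfolding c_def by (rule char_poly_fixed)
  ultimately have "\<exists>\<alpha> \<beta> \<gamma>. c j = \<alpha> * xA + \<beta> * yA + \<gamma> * \<psi> z3" if "j < p" for j
    using fixed_maximal_in_ideal that by blast
  then obtain \<alpha> \<beta> \<gamma> where c: "\<And>j. j < p \<Longrightarrow> c j = \<alpha> j * xA + \<beta> j * yA + \<gamma> j * \<psi> z3"
    by metis
  have "e ^ p = - (\<Sum>j<p. c j * e ^ j)"
    unfolding c_def by (rule char_poly_root)
  also have "(\<Sum>j<p. c j * e ^ j) = (\<Sum>j<p. (\<alpha> j * xA + \<beta> j * yA + \<gamma> j * \<psi> z3) * e ^ j)"
    using c by simp
  also have "\<dots> = (\<Sum>j<p. \<alpha> j * e ^ j) * xA + (\<Sum>j<p. \<beta> j * e ^ j) * yA + (\<Sum>j<p. \<gamma> j * e ^ j) * \<psi> z3"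
    unfolding sum_distrib_right sum.distrib[symmetric]
    by (intro sum.cong refl) (simp add: algebra_simps)
  finally have "e ^ p = (- (\<Sum>j<p. \<alpha> j * e ^ j)) * xA + (- (\<Sum>j<p. \<beta> j * e ^ j)) * yA
      + (- (\<Sum>j<p. \<gamma> j * e ^ j)) * \<psi> z3"
    by simp
  then show ?thesis by blast
qed

text \<open>A further \<open>p\<close>-th power removes \<open>\<psi> z3\<close>, whose
  \<open>p\<close>-th power is \<open>xA * yA\<close>; then raising to \<open>p ^ n\<close> suffices
  because \<open>n \<le> p ^ n\<close>.\<close>

lemma maximal_power_in_parameter_ideal:
  assumes "e $ 0 $ 0 = 0"
  shows "\<exists>\<alpha> \<beta>. e ^ (p * p * p ^ n) = \<alpha> * xA ^ n + \<beta> * yA ^ n"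
proof -
  obtain \<alpha> \<beta> \<gamma> where "e ^ p = \<alpha> * xA + \<beta> * yA + \<gamma> * \<psi> z3"
    using maximal_power_in_ideal[OF assms] by blast
  then have "(e ^ p) ^ p = \<alpha> ^ p * xA ^ p + \<beta> ^ p * yA ^ p + \<gamma> ^ p * (xA * yA)"
    by (simp add: freshman_p power_mult_distrib pres_relation xA_def yA_def)
  also have "\<dots> = (\<alpha> ^ p * xA ^ (p - 1) + \<gamma> ^ p * yA) * xA + \<beta> ^ p * yA ^ (p - 1) * yA"
    using power_minus_mult[OF p_gt_0, of xA] power_minus_mult[OF p_gt_0, of yA]
    by (simp add: distrib_right mult.assoc mult.commute[of xA yA])
  finally obtain \<alpha>' \<beta>' where "(e ^ p) ^ p = \<alpha>' * xA + \<beta>' * yA" by blast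
  then have "((e ^ p) ^ p) ^ (p ^ n) = \<alpha>' ^ (p ^ n) * xA ^ (p ^ n) + \<beta>' ^ (p ^ n) * yA ^ (p ^ n)"
    by (simp add: freshman power_mult_distrib)
  moreover have "n \<le> p ^ n"
    using prime_p prime_gt_1_nat by (intro less_imp_le power_gt_expt) auto
  then have "xA ^ (p ^ n) = xA ^ (p ^ n - n) * xA ^ n" "yA ^ (p ^ n) = yA ^ (p ^ n - n) * yA ^ n"
    by (simp_all flip: power_add)
  ultimately have "e ^ (p * p * p ^ n) =
      (\<alpha>' ^ (p ^ n) * xA ^ (p ^ n - n)) * xA ^ n + (\<beta>' ^ (p ^ n) * yA ^ (p ^ n - n)) * yA ^ n"
    by (simp add: power_mult mult.assoc)
  then show ?thesis by blast
qed

lemma no_artin_schreier_pair: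
  assumes a: "\<sigma> a = a + xA ^ n" and b: "\<sigma> b = b + yA ^ n"
  shows False
proof -
  \<comment> \<open>The increments \<open>xA^n * yA^n\<close> of the two products cancel.\<close>
  define c where "c = yA ^ n * a - xA ^ n * b"
  have "\<sigma> c = c"
    by (simp add: c_def act_diff act_mult act_power xyA_fixed a b algebra_simps)
  then obtain C where C: "c = \<psi> C" using pres_range by blast
  define k where "k = n * (p - 1)"
  \<comment> \<open>The Artin-Schreier expression of \<open>a / xA^n\<close>, cleared of its
    denominator; it is invariant because \<open>\<sigma>\<close> moves \<open>a / xA^n\<close> by
    1.\<close>
  define a' where "a' = a ^ p - xA ^ k * a"
  define b' where "b' = b ^ p - yA ^ k * b"
  have np: "n * p = k + n"
    unfolding k_def using p_gt_0 by (cases p) (simp_all add: algebra_simps)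
  have "\<sigma> a' = a'"
    by (simp add: a'_def act_diff act_mult act_power xyA_fixed a freshman_p power_mult[symmetric] np
        power_add algebra_simps)
  then obtain A where A: "a' = \<psi> A" using pres_range by blast
  have "\<sigma> b' = b'"
    by (simp add: b'_def act_diff act_mult act_power xyA_fixed b freshman_p power_mult[symmetric] np
        power_add algebra_simps)
  then obtain B where B: "b' = \<psi> B" using pres_range by blast
  \<comment> \<open>The sum form lets additivity of Frobenius apply without signs.\<close>
  have "(c + xA ^ n * b) ^ p = (yA ^ n * a) ^ p" by (simp add: c_def)
  then have "c ^ p = yA ^ (n * p) * a ^ p - xA ^ (n * p) * b ^ p"
    by (simp add: freshman_p power_mult_distrib power_mult algebra_simps)
  also have "\<dots> = yA ^ (n * p) * a' - xA ^ (n * p) * b' + (xA * yA) ^ k * c"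
    by (simp add: a'_def b'_def c_def np power_add power_mult_distrib algebra_simps)
  finally have "\<psi> (C ^ p - y3 ^ (n * p) * A + x3 ^ (n * p) * B - (x3 * y3) ^ k * C) = 0"
    by (simp add: pres_add pres_diff pres_mult pres_power A[symmetric] B[symmetric] C[symmetric]
        xA_def[symmetric] yA_def[symmetric])
  then obtain F G Q where "C = x3 ^ n * F + y3 ^ n * G + Q * (z3 ^ p - x3 * y3)"
    unfolding pres_ker k_def using frobenius_fixed_class[OF char prime_p] by metis
  then have "c = xA ^ n * \<psi> F + yA ^ n * \<psi> G"
    by (simp add: C xA_def yA_def pres_add pres_mult pres_diff pres_power pres_relation)
  \<comment> \<open>Correcting \<open>a\<close> and \<open>b\<close> by invariants makes them
    proportional without changing their increments.\<close>
  then have eq: "yA ^ n * (a - \<psi> G) = xA ^ n * (b + \<psi> F)"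
    by (simp add: c_def algebra_simps)
  obtain \<alpha> \<beta> where u: "u2 ^ (p * p * p ^ n) = \<alpha> * xA ^ n + \<beta> * yA ^ n"
    using maximal_power_in_parameter_ideal[of u2 n] by (auto simp: u2_def)
  obtain \<alpha>' \<beta>' where v: "v2 ^ (p * p * p ^ n) = \<alpha>' * xA ^ n + \<beta>' * yA ^ n"
    using maximal_power_in_parameter_ideal[of v2 n] by (auto simp: v2_def)
  have xn: "xA ^ n \<noteq> 0" using xA_nonzero by simp
  obtain h where h: "a - \<psi> G = xA ^ n * h"
    using parameters_regular[OF xn u v eq] by blast
  have "xA ^ n * \<sigma> h = \<sigma> (xA ^ n * h)"
    by (simp add: act_mult act_power xyA_fixed)
  also have "\<dots> = xA ^ n + (a - \<psi> G)"
    unfolding h[symmetric] by (simp add: act_diff pres_fixed a)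
  also have "\<dots> = xA ^ n * (h + 1)"
    unfolding h by (simp add: algebra_simps)
  finally have "\<sigma> h = h + 1" by (simp only: mult_left_cancel[OF xn])
  then have "\<sigma> h $ 0 $ 0 = h $ 0 $ 0 + 1" by simp
  then show False by (simp add: act_residue)
qed

lemma generate_funpow:
  assumes "\<tau> \<in> generate kalg_aut {\<sigma>}"
  shows "\<exists>k. \<tau> = \<sigma> ^^ k"
  using assms
proof induction
  case one
  then show ?case by (auto simp: kalg_aut_def intro: exI[of _ 0])
next
  case (incl h)
  then show ?case by (auto intro: exI[of _ 1])
next
  case (inv h)
  interpret group "kalg_aut :: ('k ps2 \<Rightarrow> 'k ps2) monoid" by (rule group_kalg_aut)
  have "\<sigma> ^^ (p - 1) \<circ> \<sigma> = id"
    using p_gt_0 aut_period by (auto simp: fun_eq_iff simp flip: funpow_Suc_right)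
  moreover have "\<sigma> ^^ (p - 1) \<in> carrier kalg_aut"
    unfolding kalg_aut_pow[symmetric] using aut by simp
  ultimately have "inv\<^bsub>kalg_aut\<^esub> \<sigma> = \<sigma> ^^ (p - 1)"
    by (intro inv_equality aut) (simp_all add: kalg_aut_def)
  then show ?case using inv by auto
next
  case (eng h1 h2)
  then obtain k l where "h1 = \<sigma> ^^ k" "h2 = \<sigma> ^^ l" by blast
  then show ?case by (intro exI[of _ "k + l"]) (simp add: kalg_aut_def funpow_add)
qed

lemma ramification_ideal_subset:
  assumes "coprime j p"
  shows "ramification_ideal \<sigma> \<subseteq> separating j"
  unfolding ramification_ideal_def
proof (rule ring.genideal_minimal[OF ring_from_type_algebra])
  interpret R: ring "PS2 :: 'k ps2 ring" by (rule ring_from_type_algebra)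
  have inv: "\<ominus>\<^bsub>PS2\<^esub> a = - a" for a :: "'k ps2"
    by (rule R.minus_equality) (simp_all add: ring_of_type_algebra_def)
  have ops: "carrier PS2 = UNIV" "f \<oplus>\<^bsub>PS2\<^esub> g = f + g" "f \<otimes>\<^bsub>PS2\<^esub> g = f * g" for f g :: "'k ps2"
    by (simp_all add: ring_of_type_algebra_def)
  show "ideal (separating j) PS2"
  proof (rule idealI[OF R.ring_axioms])
    have "- a \<in> separating j" if "a \<in> separating j" for a
      using separating_mult[OF that, of "- 1"] by simp
    then show "subgroup (separating j) (add_monoid PS2)"
      using separating_0[of j]
      by (intro R.add.subgroupI) (auto simp: inv ops separating_add)
  next
    fix f g assume f: "f \<in> separating j"
    show "g \<otimes>\<^bsub>PS2\<^esub> f \<in> separating j" "f \<otimes>\<^bsub>PS2\<^esub> g \<in> separating j"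
      using separating_mult[OF f, of g] by (simp_all add: ops mult.commute)
  qed
  show "{\<tau> a - a |\<tau> a. \<tau> \<in> generate kalg_aut {\<sigma>}} \<subseteq> separating j"
    using generate_funpow separating_diff[OF assms] by blast
qed

theorem not_ramified_precisely_at_origin: "\<not> ramified_precisely_at_origin \<sigma>"
proof
  assume ram: "ramified_precisely_at_origin \<sigma>"
  have "\<exists>n. e ^ n \<in> ramification_ideal \<sigma>" if "e $ 0 $ 0 = 0" for e
    using ram maximal_subset_Idl[OF that] unfolding ramified_precisely_at_origin_def ideal_radical_def
    by blast
  moreover have "coprime j p" if "0 < j" "j < p" for j
    using that prime_p by (metis coprime_commute prime_imp_coprime_nat nat_dvd_not_less)
  ultimately have sep: "\<exists>n. \<forall>j. 0 < j \<longrightarrow> j < p \<longrightarrow> e ^ n \<in> separating j" if "e $ 0 $ 0 = 0" for e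
    using that ramification_ideal_subset by (meson subsetD)
  \<comment> \<open>Some power of \<open>e\<close> lies in all separating ideals, so a further power
    is a trace; multiplying by invariant powers of \<open>e\<close> reaches every larger
    exponent.\<close>
  have AS: "\<exists>m. \<forall>k\<ge>m. \<exists>a. \<sigma> a = a + e ^ k" if fixed: "\<sigma> e = e" and max: "e $ 0 $ 0 = 0" for e
  proof -
    obtain n where n: "\<And>j. 0 < j \<Longrightarrow> j < p \<Longrightarrow> e ^ n \<in> separating j" using sep[OF max] by blast
    have "\<sigma> (e ^ n) = e ^ n" by (simp add: act_power fixed)
    then obtain d where d: "tr d = (e ^ n) ^ ((p - 1) * p)" using trace_eq_power n by blast
    obtain a where a: "\<sigma> a = a + tr d" using tr_eq_act_diff char by auto
    let ?m = "n * ((p - 1) * p)"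
    have "\<exists>a. \<sigma> a = a + e ^ k" if k: "k \<ge> ?m" for k
    proof -
      have "e ^ k = e ^ (k - ?m) * tr d"
        unfolding d power_mult[symmetric] power_add[symmetric] using k by simp
      then have "\<sigma> (e ^ (k - ?m) * a) = e ^ (k - ?m) * a + e ^ k"
        by (simp add: act_mult act_power fixed a distrib_left)
      then show ?thesis by blast
    qed
    then show ?thesis by blast
  qed
  have "xA $ 0 $ 0 = 0" "yA $ 0 $ 0 = 0"
    by (simp_all add: xA_def yA_def pres_residue x3_def y3_def)
  then obtain m m' where "\<forall>k\<ge>m. \<exists>a. \<sigma> a = a + xA ^ k" "\<forall>k\<ge>m'. \<exists>a. \<sigma> a = a + yA ^ k"
    using AS xyA_fixed by meson
  \<comment> \<open>As every sufficiently large exponent is allowed, \<open>m + m'\<close> serves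
    both \<open>xA\<close> and \<open>yA\<close>.\<close>
  then obtain a b where "\<sigma> a = a + xA ^ (m + m')" "\<sigma> b = b + yA ^ (m + m')"
    by (meson le_add1 le_add2)
  then show False by (rule no_artin_schreier_pair)
qed

end

section \<open>The shear as an example, and the conclusion\<close>

lemma shear_carrier: "shear c \<in> carrier kalg_aut"
  unfolding kalg_aut_carrier_iff
proof (intro conjI allI)
  show "bij (shear c)"
    by (rule o_bij[of "shear (- c)"]) (simp_all add: fun_eq_iff shear_shear shear_0)
qed (simp_all add: shear_add shear_mult shear_scalar)

lemma shear_funpow: "shear c ^^ n = shear (of_nat n * c)"
  by (induction n) (simp_all add: fun_eq_iff shear_0 shear_shear distrib_right)

text \<open>Powers add the parameters, so the order is the additive order of 1 in
  \<open>k\<close>.\<close>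

lemma ord_shear: "group.ord kalg_aut (shear (1 :: 'k::field)) = CHAR('k)"
proof -
  interpret group "kalg_aut :: ('k ps2 \<Rightarrow> 'k ps2) monoid" by (rule group_kalg_aut)
  have "shear (1 :: 'k) [^]\<^bsub>kalg_aut\<^esub> n = \<one>\<^bsub>kalg_aut\<^esub> \<longleftrightarrow> CHAR('k) dvd n" for n :: nat
  proof -
    have "\<one>\<^bsub>kalg_aut\<^esub> = (id :: 'k ps2 \<Rightarrow> 'k ps2)" by (simp add: kalg_aut_def)
    then show ?thesis
      by (simp only: kalg_aut_pow shear_funpow mult_1_right shear_eq_id_iff of_nat_eq_0_iff_char_dvd)
  qed
  then show ?thesis using ord_unique[OF shear_carrier] by blast
qed

lemma (in char_p_field) shear_presentation: "rdp_presentation (p - 1) (shear 1) \<Psi>"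
  unfolding rdp_presentation_def
  using pos by (simp add: Psi_add Psi_mult Psi_scalar range_Psi_shear Psi_eq_0_iff)

theorem mainTheorem7:
  fixes p :: nat
  assumes "CHAR('k::field) = p" and "p > 0"
  shows "(\<exists>\<sigma> :: 'k ps2 \<Rightarrow> 'k ps2.
            \<sigma> \<in> carrier kalg_aut \<and> group.ord kalg_aut \<sigma> = p \<and>
            is_rdp_A (p - 1) scalar2 (invariant_ring \<sigma>) \<and>
            Coset.order (discriminant_group (A_intersection_matrix (p - 1))) = p) \<and>
         (\<forall>\<sigma> :: 'k ps2 \<Rightarrow> 'k ps2.
            \<sigma> \<in> carrier kalg_aut \<and> group.ord kalg_aut \<sigma> = p \<and>
            is_rdp_A (p - 1) scalar2 (invariant_ring \<sigma>) \<longrightarrow>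
            ramified_in_codim_1 \<sigma>)"
proof (intro conjI allI impI)
  interpret char_p_field p "TYPE('k)"
    using assms by unfold_locales
  show "\<exists>\<sigma> :: 'k ps2 \<Rightarrow> 'k ps2.
      \<sigma> \<in> carrier kalg_aut \<and> group.ord kalg_aut \<sigma> = p \<and>
      is_rdp_A (p - 1) scalar2 (invariant_ring \<sigma>) \<and>
      Coset.order (discriminant_group (A_intersection_matrix (p - 1))) = p"
  proof (intro exI conjI)
    show "shear (1 :: 'k) \<in> carrier kalg_aut" by (rule shear_carrier)
    show "group.ord kalg_aut (shear (1 :: 'k)) = p" using ord_shear assms(1) by blast
    show "is_rdp_A (p - 1) scalar2 (invariant_ring (shear (1 :: 'k)))"
      using shear_carrier shear_presentation by (rule rdp_presentation_imp_is_rdp_A)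
    show "Coset.order (discriminant_group (A_intersection_matrix (p - 1))) = p"
      using order_discriminant_group_A[of "p - 1"] p_gt_1 by simp
  qed
next
  fix \<sigma> :: "'k ps2 \<Rightarrow> 'k ps2"
  assume \<sigma>: "\<sigma> \<in> carrier kalg_aut \<and> group.ord kalg_aut \<sigma> = p \<and>
    is_rdp_A (p - 1) scalar2 (invariant_ring \<sigma>)"
  interpret group "kalg_aut :: ('k ps2 \<Rightarrow> 'k ps2) monoid" by (rule group_kalg_aut)
  obtain \<psi> where "rdp_presentation (p - 1) \<sigma> \<psi>"
    using \<sigma> is_rdp_A_imp_rdp_presentation by blast
  moreover have "\<sigma> ^^ p = id"
    using pow_ord_eq_1[of \<sigma>] \<sigma> unfolding kalg_aut_pow by (simp add: kalg_aut_def)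
  ultimately interpret rdp_action p \<sigma> \<psi>
    using assms \<sigma> by unfold_locales auto
  show "ramified_in_codim_1 \<sigma>"
    unfolding ramified_in_codim_1_def by (rule not_ramified_precisely_at_origin)
qed

end
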